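(* Consider a stochastic variational inequality in the Euclidean ($\ell_2$) setting, with operator $g:\mathcal Z\times\mathcal X\to\mathbb R^d$ monotone, $L$-bounded and $\beta$-Lipschitz w.r.t. $\|\cdot\|_2$ and $\mathcal Z$ compact convex of diameter $B$, with $n$ samples, $n'=n/\log_2(n)$, and privacy parameters $\epsilon,\delta$. Let $\mathcal R_{\mathrm{SVI}}$ be the recursive regularization algorithm with subroutine $\mathcal A_{\mathrm{emp}}$ given by an accelerated solver followed by Gaussian noise (both described in the context). Then $\mathcal R_{\mathrm{SVI}}$ is $(\epsilon,\delta)$-differentially private and, when run with $$\lambda=\frac{48}{B}\Big(\frac{L}{\sqrt{n'}}+\frac{L\sqrt{d\log(2/\delta)}}{n'\epsilon}\Big),$$ satisfies $$\mathrm{Gap}_{\mathrm{VI}}(\mathcal R_{\mathrm{SVI}})=O\Big(\frac{\log^{3/2}(n)BL}{\sqrt n}+\frac{\log^2(n)BL\sqrt{d\log(1/\delta)}}{n\epsilon}\Big),$$ and runs in at most $O\big(n+\beta n\log(n/\delta)\big)$ gradient (operator) evaluations.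
   Context: Setting. $\mathcal X$ is a data domain, $\mathcal D$ an unknown distribution on $\mathcal X$, $S\sim\mathcal D^n$, $\mathcal Z\subseteq\mathbb R^d$ compact convex. For every $x\in\mathcal X$ and $z,z_1,z_2\in\mathcal Z$: $\langle g(z_1;x)-g(z_2;x),z_1-z_2\rangle\ge0$, $\|g(z;x)\|_2\le L$, $\|g(z_1;x)-g(z_2;x)\|_2\le\beta\|z_1-z_2\|_2$. $G_{\mathcal D}(z)=\mathbb E_{x\sim\mathcal D}[g(z;x)]$. Equilibrium of $G$: $z^*\in\mathcal Z$ with $\langle G(z^* ),z^*-z\rangle\le0$ for all $z\in\mathcal Z$. Strong VI-gap: $\mathrm{Gap}_{\mathrm{VI}}(\mathcal A)=\mathbb E_{\mathcal A,S}\big[\max_{z\in\mathcal Z}\langle G_{\mathcal D}(z),\mathcal A(S)-z\rangle\big]$. $(\epsilon,\delta)$-differential privacy: for all $S,S'$ differing in one data point and all events $\mathcal E$, $\mathbb P(\mathcal A(S)\in\mathcal E)\le e^\epsilon\mathbb P(\mathcal A(S')\in\mathcal E)+\delta$. A gradient evaluation is one evaluation of $g(z;x)$. Algorithm $\mathcal R_{\mathrm{SVI}}$ (Euclidean case). Input: the dataset $S$, a regularization parameter $\lambda\ge\frac{L}{B\sqrt n}$, and the regularizing operator $\rho=\nabla(\frac12\|\cdot\|_2^2)$, i.e. $\rho(u)=u$. Let $T=\log_2\big(\frac{L}{B\lambda}\big)$ and let $S_1,\dots,S_T$ be disjoint subsets of $S$ of size $n'$. Let $\bar z_0\in\mathcal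 Z$ be arbitrary and $g^{(1)}(z;x)=g(z;x)+2\lambda\rho(z-\bar z_0)$. For $t=1,\dots,T$: $\bar z_t=\mathcal A_{\mathrm{emp}}(S_t,g^{(t)},\bar z_{t-1},\frac{B}{2^t})$ and $g^{(t+1)}(z;x)=g^{(t)}(z;x)+2^{t+1}\lambda\rho(z-\bar z_t)$. Output $\bar z_T$. Subroutine $\mathcal A_{\mathrm{emp}}$ at round $t$. Let $z^*_{S,t}$ be the equilibrium of $G_S^{(t)}(z)=\frac1{n'}\sum_{x\in S_t}g^{(t)}(z;x)$. Use the accelerated solver below to find $\hat z_t$ with $\mathbb E\|\hat z_t-z^*_{S,t}\|_2\le\frac{\delta L}{5\cdot2^t\lambda n'}$, and output $\bar z_t=\hat z_t+\xi_t$, where $\xi_t\sim\mathcal N(0,\sigma_t^2I_d)$ with $\sigma_t=\frac{8L\sqrt{\log(2/\delta)}}{2^t\lambda n'\epsilon}$. Accelerated solver (known result of Palaniappan and Bach): there is a universal constant $c$ such that if $g(\cdot;x)$ is monotone and $\beta$-Lipschitz, $r$ is a $\mu$-strongly monotone operator, and $z_S^*$ is the equilibrium of $\frac1m\sum_{x\in S}g(z;x)+r(z)$ for a dataset $S$ of size $m$, then for any $K>0$ there is an algorithm which in $O(m+\sqrt m\,K\frac\beta\mu)$ gradient evaluations finds $\bar z$ with $\mathbb E\|z_S^*-\bar z\|_2\le cBe^{-K}$.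
   Formalization: Privacy is claimed for ε ≤ 2 log(2/δ) (false for ε much larger than log(1/δ)), the gap bound for δ ≤ 1/2 (it fails as δ → 1), and the constant in the evaluation bound depends on B/L and the solver's constants, as the stated bound is not scale invariant. *)

theory Defs
  imports "HOL-Probability.Probability"
begin

section \<open>Stochastic variational inequalities\<close>

text \<open>
  The data domain is a measurable space \<open>X\<close>; the operator is curried as \<open>g z x\<close>. A dataset of
  size \<open>n\<close> is an element of the product space over the index set \<open>{..<n}\<close>. The ambient space
  \<open>'a\<close> is an arbitrary Euclidean space, of dimension \<open>DIM('a)\<close>.
\<close>

definition strongly_monotone_on ::
    "real \<Rightarrow> 'a::real_inner set \<Rightarrow> ('a \<Rightarrow> 'a) \<Rightarrow> bool" where
  "strongly_monotone_on \<mu> Z r \<longleftrightarrow>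
     (\<forall>u\<in>Z. \<forall>v\<in>Z. \<mu> * (norm (u - v))\<^sup>2 \<le> inner (r u - r v) (u - v))"

definition monotone_operator_on :: "'a::real_inner set \<Rightarrow> ('a \<Rightarrow> 'a) \<Rightarrow> bool" where
  "monotone_operator_on Z r \<longleftrightarrow> (\<forall>u\<in>Z. \<forall>v\<in>Z. 0 \<le> inner (r u - r v) (u - v))"

definition equilibrium :: "'a::real_inner set \<Rightarrow> ('a \<Rightarrow> 'a) \<Rightarrow> 'a \<Rightarrow> bool" where
  "equilibrium Z G z \<longleftrightarrow> z \<in> Z \<and> (\<forall>w\<in>Z. inner (G z) (z - w) \<le> 0)"

definition svi_operator ::
    "'x measure \<Rightarrow> 'a::euclidean_space set \<Rightarrow> ('a \<Rightarrow> 'x \<Rightarrow> 'a) \<Rightarrow> real \<Rightarrow> real \<Rightarrow> bool" where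
  "svi_operator X Z g L \<beta> \<longleftrightarrow>
     (\<forall>z\<in>Z. g z \<in> borel_measurable X) \<and>
     (\<forall>x\<in>space X. monotone_operator_on Z (\<lambda>z. g z x) \<and>
                  (\<forall>z\<in>Z. norm (g z x) \<le> L) \<and>
                  \<beta>-lipschitz_on Z (\<lambda>z. g z x))"

definition population_operator ::
    "'x measure \<Rightarrow> ('a::euclidean_space \<Rightarrow> 'x \<Rightarrow> 'a) \<Rightarrow> 'a \<Rightarrow> 'a" where
  "population_operator D g z = (\<integral>x. g z x \<partial>D)"

abbreviation dataset_space :: "nat \<Rightarrow> 'x measure \<Rightarrow> (nat \<Rightarrow> 'x) measure" where
  "dataset_space n X \<equiv> Pi\<^sub>M {..<n} (\<lambda>_. X)"

definition vi_loss ::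
    "'x measure \<Rightarrow> 'a::euclidean_space set \<Rightarrow> ('a \<Rightarrow> 'x \<Rightarrow> 'a) \<Rightarrow> 'a \<Rightarrow> real" where
  "vi_loss D Z g w = (SUP z\<in>Z. inner (population_operator D g z) (w - z))"

text \<open>
  A randomized algorithm is a function of the dataset and of a random element drawn from the
  probability space \<open>R\<close>. Because the Bochner integral of a non-integrable function is \<open>0\<close>, bounds on
  \<open>vi_gap\<close> only carry content together with \<open>vi_gap_exists\<close>.
\<close>

definition vi_gap_exists ::
    "'x measure \<Rightarrow> nat \<Rightarrow> 'a::euclidean_space set \<Rightarrow> ('a \<Rightarrow> 'x \<Rightarrow> 'a) \<Rightarrow>
     'r measure \<Rightarrow> ((nat \<Rightarrow> 'x) \<Rightarrow> 'r \<Rightarrow> 'a) \<Rightarrow> bool" where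
  "vi_gap_exists D n Z g R A \<longleftrightarrow>
     integrable (dataset_space n D \<Otimes>\<^sub>M R) (\<lambda>(S, \<omega>). vi_loss D Z g (A S \<omega>))"

definition vi_gap ::
    "'x measure \<Rightarrow> nat \<Rightarrow> 'a::euclidean_space set \<Rightarrow> ('a \<Rightarrow> 'x \<Rightarrow> 'a) \<Rightarrow>
     'r measure \<Rightarrow> ((nat \<Rightarrow> 'x) \<Rightarrow> 'r \<Rightarrow> 'a) \<Rightarrow> real" where
  "vi_gap D n Z g R A = (\<integral>(S, \<omega>). vi_loss D Z g (A S \<omega>) \<partial>(dataset_space n D \<Otimes>\<^sub>M R))"


section \<open>Differential privacy\<close>

definition neighbouring :: "nat \<Rightarrow> (nat \<Rightarrow> 'x) \<Rightarrow> (nat \<Rightarrow> 'x) \<Rightarrow> bool" where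
  "neighbouring n S S' \<longleftrightarrow> (\<exists>i<n. \<forall>j<n. j \<noteq> i \<longrightarrow> S j = S' j)"

definition differentially_private ::
    "real \<Rightarrow> real \<Rightarrow> 'x measure \<Rightarrow> nat \<Rightarrow> ((nat \<Rightarrow> 'x) \<Rightarrow> 'a measure) \<Rightarrow> bool" where
  "differentially_private \<epsilon> \<delta> X n M \<longleftrightarrow>
     (\<forall>S\<in>space (dataset_space n X). \<forall>S'\<in>space (dataset_space n X). neighbouring n S S' \<longrightarrow>
        (\<forall>E\<in>sets (M S). measure (M S) E \<le> exp \<epsilon> * measure (M S') E + \<delta>))"

definition gaussian_noise :: "real \<Rightarrow> 'a::euclidean_space measure" where
  "gaussian_noise \<sigma> = density lborel (\<lambda>x. ennreal (\<Prod>b\<in>Basis. normal_density 0 \<sigma> (inner x b)))"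


section \<open>Programs with access to a gradient oracle\<close>

text \<open>
  A program reaches the operator only through \<open>Eval z x k\<close>, which requests \<open>g z x\<close> and
  continues as \<open>k (g z x)\<close>; \<open>evals\<close> counts the requests made along the actual execution.
  Random choices are made by drawing the program at random.
\<close>

datatype ('a, 'x, 'r) grad_prog =
    Return 'r
  | Eval 'a 'x "'a \<Rightarrow> ('a, 'x, 'r) grad_prog"

primrec run :: "('a \<Rightarrow> 'x \<Rightarrow> 'a) \<Rightarrow> ('a, 'x, 'r) grad_prog \<Rightarrow> 'r" where
  "run g (Return r) = r"
| "run g (Eval z x k) = run g (k (g z x))"

primrec evals :: "('a \<Rightarrow> 'x \<Rightarrow> 'a) \<Rightarrow> ('a, 'x, 'r) grad_prog \<Rightarrow> nat" where
  "evals g (Return r) = 0"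
| "evals g (Eval z x k) = Suc (evals g (k (g z x)))"

primrec and_then ::
    "('a, 'x, 'r) grad_prog \<Rightarrow> ('r \<Rightarrow> ('a, 'x, 's) grad_prog) \<Rightarrow> ('a, 'x, 's) grad_prog" where
  "and_then (Return r) f = f r"
| "and_then (Eval z x k) f = Eval z x (\<lambda>a. and_then (k a) f)"


section \<open>The accelerated solver\<close>

text \<open>
  A solver draws \<open>\<omega>\<close> from \<open>W\<close> and receives a dataset and a regularizing operator \<open>r\<close>, whose
  evaluations are free. The predicate says that \<open>P\<close> is the algorithm provided by the solver's
  convergence theorem for the accuracy parameter \<open>K\<close>, datasets of size \<open>m\<close> and strong monotonicity
  parameter \<open>\<mu>\<close>; \<open>c\<close> and \<open>c\<^sub>0\<close> are the constants of its accuracy and of its \<open>O\<close> complexity bound.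
  The first measurability clause is needed since the centre of the regularizer is itself
  random when the solver is called repeatedly.
\<close>

definition accelerated_solver ::
    "real \<Rightarrow> real \<Rightarrow> 'x measure \<Rightarrow> 'a::euclidean_space set \<Rightarrow> ('a \<Rightarrow> 'x \<Rightarrow> 'a) \<Rightarrow> real \<Rightarrow>
     nat \<Rightarrow> real \<Rightarrow> real \<Rightarrow> 'w measure \<Rightarrow>
     ('w \<Rightarrow> (nat \<Rightarrow> 'x) \<Rightarrow> ('a \<Rightarrow> 'a) \<Rightarrow> ('a, 'x, 'a) grad_prog) \<Rightarrow> bool" where
  "accelerated_solver c c\<^sub>0 X Z g \<beta> m \<mu> K W P \<longleftrightarrow>
     prob_space W \<and>
     (\<forall>a\<ge>\<mu>. (\<lambda>((\<omega>, w), S). run g (P \<omega> S (\<lambda>z. a *\<^sub>R (z - w))))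
        \<in> borel_measurable ((W \<Otimes>\<^sub>M borel) \<Otimes>\<^sub>M dataset_space m X)) \<and>
     (\<forall>S\<in>space (dataset_space m X). \<forall>r. continuous_on Z r \<and> strongly_monotone_on \<mu> Z r \<longrightarrow>
        (\<lambda>\<omega>. run g (P \<omega> S r)) \<in> borel_measurable W \<and>
        (\<forall>\<omega>\<in>space W.
           real (evals g (P \<omega> S r)) \<le> c\<^sub>0 * (real m + sqrt (real m) * K * \<beta> / \<mu>)) \<and>
        (\<forall>z. equilibrium Z (\<lambda>u. (1 / real m) *\<^sub>R (\<Sum>j<m. g u (S j)) + r u) z \<longrightarrow>
           (\<integral>\<^sup>+\<omega>. ennreal (norm (z - run g (P \<omega> S r))) \<partial>W)
             \<le> ennreal (c * diameter Z * exp (- K))))"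


section \<open>Recursive regularization\<close>

text \<open>Real-valued quantities that have to be integers are rounded down.\<close>

definition batch_size :: "nat \<Rightarrow> nat" where
  "batch_size n = nat \<lfloor>real n / log 2 (real n)\<rfloor>"

definition num_rounds :: "real \<Rightarrow> real \<Rightarrow> real \<Rightarrow> nat" where
  "num_rounds L B lam = nat \<lfloor>log 2 (L / (B * lam))\<rfloor>"

definition noise_scale :: "real \<Rightarrow> real \<Rightarrow> nat \<Rightarrow> real \<Rightarrow> real \<Rightarrow> nat \<Rightarrow> real" where
  "noise_scale L lam m \<epsilon> \<delta> t = 8 * L * sqrt (ln (2 / \<delta>)) / (2 ^ t * lam * real m * \<epsilon>)"

definition solver_accuracy :: "real \<Rightarrow> real \<Rightarrow> nat \<Rightarrow> real \<Rightarrow> nat \<Rightarrow> real" where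
  "solver_accuracy L lam m \<delta> t = \<delta> * L / (5 * 2 ^ t * lam * real m)"

text \<open>
  The solver is run with the least \<open>K\<close> for which \<open>c * B * exp (- K)\<close> is at most the required
  accuracy, but at least with \<open>K = 1\<close>, as its guarantee is for positive \<open>K\<close> only.
\<close>

definition solver_K :: "real \<Rightarrow> real \<Rightarrow> real \<Rightarrow> real \<Rightarrow> nat \<Rightarrow> real \<Rightarrow> nat \<Rightarrow> real" where
  "solver_K c L B lam m \<delta> t = max 1 (ln (c * B / solver_accuracy L lam m \<delta> t))"

text \<open>
  The \<open>t\<close>-th batch \<open>S\<^sub>t\<close> consists of the points with the indices \<open>idx t 0, \<dots>, idx t (m - 1)\<close>. The
  batches are disjoint subsets of the dataset.
\<close>

definition disjoint_batches :: "nat \<Rightarrow> nat \<Rightarrow> nat \<Rightarrow> (nat \<Rightarrow> nat \<Rightarrow> nat) \<Rightarrow> bool" where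
  "disjoint_batches n T m idx \<longleftrightarrow>
     inj_on (\<lambda>(t, j). idx t j) ({1..T} \<times> {..<m}) \<and>
     (\<forall>t\<in>{1..T}. \<forall>j<m. idx t j < n)"

definition batch :: "nat \<Rightarrow> (nat \<Rightarrow> nat \<Rightarrow> nat) \<Rightarrow> nat \<Rightarrow> (nat \<Rightarrow> 'x) \<Rightarrow> nat \<Rightarrow> 'x" where
  "batch m idx t S = (\<lambda>j\<in>{..<m}. S (idx t j))"

text \<open>
  One call of the subroutine, on the operator \<open>\<lambda>z x. g z x + r z\<close>: the solver \<open>P\<close> with random
  seed \<open>\<omega>\<close>, followed by the addition of the noise \<open>\<xi>\<close>.
\<close>

definition A_emp ::
    "('w \<Rightarrow> (nat \<Rightarrow> 'x) \<Rightarrow> ('a \<Rightarrow> 'a) \<Rightarrow> ('a, 'x, 'a) grad_prog) \<Rightarrow> (nat \<Rightarrow> 'x) \<Rightarrow>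
     ('a \<Rightarrow> 'a) \<Rightarrow> 'w \<times> 'a::euclidean_space \<Rightarrow> ('a, 'x, 'a) grad_prog" where
  "A_emp P S r = (\<lambda>(\<omega>, \<xi>). and_then (P \<omega> S r) (\<lambda>z. Return (z + \<xi>)))"

text \<open>
  The state after \<open>t\<close> rounds is the current point (\<open>z\<^sub>0\<close> for \<open>t = 0\<close>) together with the
  operator \<open>r\<close> for which round \<open>t + 1\<close> works on \<open>\<lambda>z x. g z x + r z\<close>. The randomness \<open>\<rho> t\<close> of
  round \<open>t\<close> consists of the solver's seed and the noise vector.
\<close>

primrec R_SVI_state ::
    "real \<Rightarrow> nat \<Rightarrow> (nat \<Rightarrow> nat \<Rightarrow> nat) \<Rightarrow>
     (nat \<Rightarrow> 'w \<Rightarrow> (nat \<Rightarrow> 'x) \<Rightarrow> ('a \<Rightarrow> 'a) \<Rightarrow> ('a, 'x, 'a) grad_prog) \<Rightarrow> 'a \<Rightarrow>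
     (nat \<Rightarrow> 'x) \<Rightarrow> (nat \<Rightarrow> 'w \<times> 'a::euclidean_space) \<Rightarrow> nat \<Rightarrow>
     ('a, 'x, 'a \<times> ('a \<Rightarrow> 'a)) grad_prog" where
  "R_SVI_state lam m idx P z\<^sub>0 S \<rho> 0 = Return (z\<^sub>0, \<lambda>z. (2 * lam) *\<^sub>R (z - z\<^sub>0))"
| "R_SVI_state lam m idx P z\<^sub>0 S \<rho> (Suc t) =
     and_then (R_SVI_state lam m idx P z\<^sub>0 S \<rho> t)
       (\<lambda>(_, r). and_then (A_emp (P (Suc t)) (batch m idx (Suc t) S) r (\<rho> (Suc t)))
          (\<lambda>w. Return (w, \<lambda>z. r z + (2 ^ (Suc t + 1) * lam) *\<^sub>R (z - w))))"

definition R_SVI ::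
    "real \<Rightarrow> nat \<Rightarrow> nat \<Rightarrow> (nat \<Rightarrow> nat \<Rightarrow> nat) \<Rightarrow>
     (nat \<Rightarrow> 'w \<Rightarrow> (nat \<Rightarrow> 'x) \<Rightarrow> ('a \<Rightarrow> 'a) \<Rightarrow> ('a, 'x, 'a) grad_prog) \<Rightarrow> 'a \<Rightarrow>
     (nat \<Rightarrow> 'x) \<Rightarrow> (nat \<Rightarrow> 'w \<times> 'a::euclidean_space) \<Rightarrow> ('a, 'x, 'a) grad_prog" where
  "R_SVI lam T m idx P z\<^sub>0 S \<rho> =
     and_then (R_SVI_state lam m idx P z\<^sub>0 S \<rho> T) (\<lambda>(w, _). Return w)"

definition R_SVI_randomness ::
    "nat \<Rightarrow> (nat \<Rightarrow> 'w measure) \<Rightarrow> (nat \<Rightarrow> real) \<Rightarrow> (nat \<Rightarrow> 'w \<times> 'a::euclidean_space) measure" where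
  "R_SVI_randomness T W \<sigma> = Pi\<^sub>M {1..T} (\<lambda>t. W t \<Otimes>\<^sub>M gaussian_noise (\<sigma> t))"

end

theory Submission
  imports Defs
begin

text \<open>
  Privacy. Strong monotonicity makes the equilibrium of a round's regularized empirical operator move by
  at most \<open>\<Delta> = 2 * L / (2 ^ t * lam * m)\<close> when one data point changes, so a single round is a Gaussian
  mechanism up to the solver's inaccuracy, which is absorbed into \<open>\<delta>\<close> by Markov's inequality. A data
  point occurs in at most one batch, and the later rounds are post-processing.

  Gap. Let \<open>u\<close> be the equilibrium of the population operator plus the current regularizer. As a batch is
  independent of everything before it, the distance from the new point to \<open>u\<close> has expectation of order
  \<open>B / 2 ^ t\<close>: stability of equilibria reduces the sampling error to the deviation of an empirical mean
  at \<open>u\<close>. Adding the next regularizer is a proximal step, which moves the equilibrium by no more than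
  this distance. Hence the total regularizer at the last equilibrium, which bounds the strong gap
  there, has norm \<open>O(lam * B * log n)\<close>.
\<close>

text \<open>The noise may push every point but the first out of \<open>Z\<close>, so neither the
  points nor the centres of the regularizers are bounded. Distances are therefore measured from
  equilibria, which do lie in \<open>Z\<close>, and the centres are arbitrary vectors throughout.
  The weights of the regularizers double from round to round while the error halves, so every round
  adds the same amount, of order \<open>lam * B\<close>, to the total regularizer. As
  \<open>2 ^ T * lam * B\<close> is about \<open>L\<close>, the last error costs about
  \<open>L * B / 2 ^ T\<close>, again of order \<open>lam * B\<^sup>2\<close>.

  Measurability shapes the argument: an empirical equilibrium depends on the data in an uncontrolled
  way, so it is used for one fixed batch at a time and is never integrated over the data, whereas
  the population equilibrium is a 1-Lipschitz function of the random centre. Independence is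
  expressed by Fubini: a state is a function that ignores the coordinates of later rounds. The
  constant 8 in the noise scale leaves room for means at distance \<open>2 * \<Delta>\<close>, one
  \<open>\<Delta>\<close> for the sensitivity and one for the two solver errors.\<close>

lemma run_and_then: "run g (and_then p f) = run g (f (run g p))"
  by (induction p) auto

lemma evals_and_then: "evals g (and_then p f) = evals g p + evals g (f (run g p))"
  by (induction p) auto

section \<open>Equilibria of monotone operators\<close>

text \<open>Brouwer's theorem gives a fixed point of the projected step
  \<open>closest_point Z (z - G z)\<close>; the obtuse angle property of the projection is then the
  variational inequality at that point.\<close>

lemma equilibrium_exists:
  fixes Z :: "'a::euclidean_space set"
  assumes "compact Z" "convex Z" "Z \<noteq> {}" "continuous_on Z G"
  shows "\<exists>z. equilibrium Z G z"
proof -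
  have cl: "closed Z" using assms by (simp add: compact_imp_closed)
  have "continuous_on Z (\<lambda>z. closest_point Z (z - G z))"
    using assms cl
    by (intro continuous_on_compose2[OF continuous_on_closest_point[of Z UNIV]] continuous_intros) auto
  then obtain z where z: "z \<in> Z" "closest_point Z (z - G z) = z"
    using brouwer[OF assms(1-3), of "\<lambda>z. closest_point Z (z - G z)"] closest_point_in_set[OF cl assms(3)]
    by blast
  have "inner (G z) (z - w) \<le> 0" if "w \<in> Z" for w
    using closest_point_dot[OF assms(2) cl that, of "z - G z"] z(2) by (simp add: algebra_simps)
  with z show ?thesis by (auto simp: equilibrium_def)
qed

text \<open>Each variational inequality is tested with the other solution and both are added to
  strong monotonicity. The perturbation is measured at the single point \<open>z'\<close>; later
  this may be a population equilibrium that does not depend on the batch, so no uniform deviation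
  bound is required.\<close>

lemma equilibrium_stability:
  assumes "equilibrium Z G z" "equilibrium Z G' z'" "strongly_monotone_on \<mu> Z G" "\<mu> > 0"
  shows "norm (z - z') \<le> norm (G' z' - G z') / \<mu>"
proof -
  have "\<mu> * (norm (z - z'))\<^sup>2 \<le> inner (G z - G z') (z - z')"
    using assms by (auto simp: strongly_monotone_on_def equilibrium_def)
  also have "\<dots> = inner (G z) (z - z') + inner (G' z') (z' - z) + inner (G' z' - G z') (z - z')"
    by (simp add: algebra_simps)
  also have "\<dots> \<le> inner (G' z' - G z') (z - z')"
    using assms by (simp add: equilibrium_def add_nonpos_nonpos)
  also have "\<dots> \<le> norm (G' z' - G z') * norm (z - z')"
    by (rule norm_cauchy_schwarz)
  finally have "\<mu> * norm (z - z') * norm (z - z') \<le> norm (G' z' - G z') * norm (z - z')"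
    by (simp add: power2_eq_square mult.assoc)
  then have "\<mu> * norm (z - z') \<le> norm (G' z' - G z')"
    by (cases "z = z'") auto
  with assms(4) show ?thesis by (simp add: field_simps)
qed

lemma strongly_monotone_on_add:
  assumes "monotone_operator_on Z G" "\<mu> \<le> a"
  shows "strongly_monotone_on \<mu> Z (\<lambda>u. G u + a *\<^sub>R (u - w))"
proof -
  have "\<mu> * (norm (u - v))\<^sup>2 \<le> inner (G u + a *\<^sub>R (u - w) - (G v + a *\<^sub>R (v - w))) (u - v)"
    if "u \<in> Z" "v \<in> Z" for u v
  proof -
    have "\<mu> * (norm (u - v))\<^sup>2 \<le> a * (norm (u - v))\<^sup>2"
      using assms(2) by (intro mult_right_mono) auto
    moreover have "0 \<le> inner (G u - G v) (u - v)"
      using assms(1) that by (auto simp: monotone_operator_on_def)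
    moreover have "inner (G u + a *\<^sub>R (u - w) - (G v + a *\<^sub>R (v - w))) (u - v) =
        inner (G u - G v) (u - v) + a * (norm (u - v))\<^sup>2"
      by (simp add: power2_norm_eq_inner algebra_simps)
    ultimately show ?thesis by linarith
  qed
  then show ?thesis by (simp add: strongly_monotone_on_def)
qed

text \<open>Testing the two inequalities against each other shows that the angle at \<open>v\<close>
  between \<open>p\<close> and \<open>u\<close> is not acute, so the squared distance from
  \<open>p\<close> to \<open>u\<close> dominates the sum of the squares of the two other sides. The
  centre \<open>p\<close> may lie outside \<open>Z\<close>, as noisy points do.\<close>

lemma equilibrium_proximal_step:
  assumes u: "equilibrium Z G u" and v: "equilibrium Z (\<lambda>z. G z + c *\<^sub>R (z - p)) v"
    and "monotone_operator_on Z G" "c > 0"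
  shows "norm (v - u) \<le> norm (p - u)" "norm (v - p) \<le> norm (p - u)"
proof -
  have "0 \<le> inner (G v - G u) (v - u)"
    using assms by (auto simp: monotone_operator_on_def equilibrium_def)
  moreover have "inner (G u) (u - v) \<le> 0"
    using u v by (auto simp: equilibrium_def)
  moreover have "inner (G v + c *\<^sub>R (v - p)) (v - u) \<le> 0"
    using u v by (auto simp: equilibrium_def)
  ultimately have "c * inner (v - p) (v - u) \<le> 0"
    by (simp add: algebra_simps)
  then have *: "inner (v - p) (v - u) \<le> 0"
    using \<open>c > 0\<close> by (simp add: mult_le_0_iff)
  have "(norm (p - u))\<^sup>2 = (norm (v - u))\<^sup>2 + (norm (v - p))\<^sup>2 - 2 * inner (v - p) (v - u)"
    by (simp add: power2_norm_eq_inner algebra_simps inner_commute)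
  then have "(norm (p - u))\<^sup>2 \<ge> (norm (v - u))\<^sup>2 + (norm (v - p))\<^sup>2"
    using * by linarith
  then have "(norm (p - u))\<^sup>2 \<ge> (norm (v - u))\<^sup>2" "(norm (p - u))\<^sup>2 \<ge> (norm (v - p))\<^sup>2"
    by (smt (verit) zero_le_power2)+
  then show "norm (v - u) \<le> norm (p - u)" "norm (v - p) \<le> norm (p - u)"
    by (auto intro: power2_le_imp_le)
qed

section \<open>Gaussian noise\<close>

text \<open>The rotation-invariant form of the product density, in which shifted densities are
  compared by completing a square in the norm.\<close>

definition gaussian_density :: "real \<Rightarrow> 'a::euclidean_space \<Rightarrow> real" where
  "gaussian_density \<sigma> x = (1 / sqrt (2 * pi * \<sigma>\<^sup>2)) ^ DIM('a) * exp (- (norm x)\<^sup>2 / (2 * \<sigma>\<^sup>2))"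

lemma norm_squared_eq_sum_Basis:
  fixes x :: "'a::euclidean_space"
  shows "(norm x)\<^sup>2 = (\<Sum>b\<in>Basis. (inner x b)\<^sup>2)"
  by (subst power2_norm_eq_inner, subst euclidean_inner) (simp add: power2_eq_square)

lemma prod_normal_density:
  fixes x :: "'a::euclidean_space"
  shows "(\<Prod>b\<in>Basis. normal_density 0 \<sigma> (inner x b)) = gaussian_density \<sigma> x"
proof -
  have "exp (- (norm x)\<^sup>2 / (2 * \<sigma>\<^sup>2)) = (\<Prod>b\<in>Basis. exp (- (inner x b)\<^sup>2 / (2 * \<sigma>\<^sup>2)))"
    by (simp add: norm_squared_eq_sum_Basis exp_sum[symmetric] sum_divide_distrib sum_negf)
  then show ?thesis
    by (simp add: gaussian_density_def normal_density_def prod.distrib prod_dividef power_one_over)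
qed

lemma gaussian_noise_eq: "gaussian_noise \<sigma> = density lborel (\<lambda>x. ennreal (gaussian_density \<sigma> x))"
  by (simp add: gaussian_noise_def prod_normal_density)

lemma gaussian_density_nonneg: "0 \<le> gaussian_density \<sigma> x"
  by (simp add: gaussian_density_def)

lemma borel_measurable_gaussian_density [measurable]: "gaussian_density \<sigma> \<in> borel_measurable borel"
  unfolding gaussian_density_def[abs_def] by measurable

lemma sets_gaussian_noise [measurable_cong, simp]: "sets (gaussian_noise \<sigma>) = sets borel"
  by (simp add: gaussian_noise_def)

lemma space_gaussian_noise [simp]: "space (gaussian_noise \<sigma>) = UNIV"
  by (simp add: gaussian_noise_def)

lemma nn_integral_gaussian_density:
  assumes "\<sigma> > 0"
  shows "(\<integral>\<^sup>+x. ennreal (gaussian_density \<sigma> (x::'a::euclidean_space)) \<partial>lborel) = 1"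
proof -
  have "(\<integral>\<^sup>+x. ennreal (gaussian_density \<sigma> (x::'a)) \<partial>lborel) =
      (\<integral>\<^sup>+x. (\<Prod>b\<in>Basis. ennreal (normal_density 0 \<sigma> (inner (x::'a) b))) \<partial>lborel)"
    by (simp add: prod_normal_density[symmetric] prod_ennreal)
  also have "\<dots> = (\<Prod>b\<in>(Basis :: 'a set). \<integral>\<^sup>+x. ennreal (normal_density 0 \<sigma> x) \<partial>lborel)"
    by (subst nn_integral_lborel_prod) auto
  also have "(\<integral>\<^sup>+x. ennreal (normal_density 0 \<sigma> x) \<partial>lborel) = 1"
    using assms by (subst nn_integral_eq_integral) auto
  finally show ?thesis by simp
qed

lemma prob_space_gaussian_noise: "\<sigma> > 0 \<Longrightarrow> prob_space (gaussian_noise \<sigma>)"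
  by (rule prob_spaceI) (simp add: gaussian_noise_eq emeasure_density nn_integral_gaussian_density)

lemma nn_integral_lborel_shift:
  fixes u :: "'a::euclidean_space"
  assumes [measurable]: "f \<in> borel_measurable borel"
  shows "(\<integral>\<^sup>+x. f (x + u) \<partial>lborel) = (\<integral>\<^sup>+x. f x \<partial>lborel)"
proof -
  have "(\<integral>\<^sup>+x. f x \<partial>lborel) = (\<integral>\<^sup>+x. f x \<partial>distr lborel borel ((+) u))"
    by (simp add: lborel_distr_plus)
  also have "\<dots> = (\<integral>\<^sup>+x. f (x + u) \<partial>lborel)"
    by (subst nn_integral_distr) (simp_all add: add.commute)
  finally show ?thesis by simp
qed

text \<open>Moving the shift into the density makes the laws with different means comparable
  pointwise with respect to Lebesgue measure.\<close>

lemma nn_integral_gaussian_noise_shift: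
  fixes v :: "'a::euclidean_space"
  assumes [measurable]: "f \<in> borel_measurable borel"
  shows "(\<integral>\<^sup>+x. f (v + x) \<partial>gaussian_noise \<sigma>) =
    (\<integral>\<^sup>+x. ennreal (gaussian_density \<sigma> (x - v)) * f x \<partial>lborel)"
proof -
  have "(\<integral>\<^sup>+x. f (v + x) \<partial>gaussian_noise \<sigma>) =
      (\<integral>\<^sup>+x. ennreal (gaussian_density \<sigma> x) * f (v + x) \<partial>lborel)"
    unfolding gaussian_noise_eq by (subst nn_integral_density) simp_all
  also have "\<dots> = (\<integral>\<^sup>+x. ennreal (gaussian_density \<sigma> (x + v - v)) * f (x + v) \<partial>lborel)"
    by (simp add: add.commute)
  also have "\<dots> = (\<integral>\<^sup>+x. ennreal (gaussian_density \<sigma> (x - v)) * f x \<partial>lborel)"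
    using nn_integral_lborel_shift[of "\<lambda>x. ennreal (gaussian_density \<sigma> (x - v)) * f x" v] by simp
  finally show ?thesis .
qed

text \<open>Where the density \<open>p\<close> centred at \<open>v\<close> exceeds \<open>exp \<epsilon>\<close> times the density \<open>p'\<close> centred at \<open>v'\<close>, it is at
  most \<open>p * (p / p') powr s * exp (- s * \<epsilon>)\<close>, which up to a constant is the Gaussian density centred at
  \<open>v + s *\<^sub>R (v - v')\<close>. Integrating this gives the Chernoff bound on the privacy loss.\<close>

lemma gaussian_density_le:
  fixes x :: "'a::euclidean_space"
  assumes "\<sigma> > 0" "s \<ge> 0"
  shows "gaussian_density \<sigma> (x - v) \<le> exp \<epsilon> * gaussian_density \<sigma> (x - v') +
    exp (- s * \<epsilon> + s * (1 + s) * (norm (v - v'))\<^sup>2 / (2 * \<sigma>\<^sup>2)) *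
      gaussian_density \<sigma> (x - (v + s *\<^sub>R (v - v')))"
proof (cases "gaussian_density \<sigma> (x - v) \<le> exp \<epsilon> * gaussian_density \<sigma> (x - v')")
  case True
  then show ?thesis
    by (smt (verit) gaussian_density_nonneg exp_ge_zero mult_nonneg_nonneg)
next
  case False
  define C where "C = (1 / sqrt (2 * pi * \<sigma>\<^sup>2)) ^ DIM('a)"
  have C: "C > 0" using assms by (simp add: C_def)
  define y y' where "y = x - v" and "y' = x - v'"
  have e: "x - (v + s *\<^sub>R (v - v')) = (1 + s) *\<^sub>R y - s *\<^sub>R y'" "v - v' = y' - y"
    by (simp_all add: y_def y'_def algebra_simps)
  have "C * exp (- (norm y)\<^sup>2 / (2 * \<sigma>\<^sup>2)) > C * exp (\<epsilon> + - (norm y')\<^sup>2 / (2 * \<sigma>\<^sup>2))"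
    using False unfolding gaussian_density_def C_def[symmetric] y_def[symmetric] y'_def[symmetric] exp_add not_le
    by (simp only: mult.left_commute)
  then have *: "- (norm y)\<^sup>2 / (2 * \<sigma>\<^sup>2) > \<epsilon> + - (norm y')\<^sup>2 / (2 * \<sigma>\<^sup>2)"
    using C by simp
  \<comment> \<open>Completing the square: the tilted density is again Gaussian, and the last
    summand is the constant that remains.\<close>
  have "(norm ((1 + s) *\<^sub>R y - s *\<^sub>R y'))\<^sup>2 = (1 + s) * (norm y)\<^sup>2 - s * (norm y')\<^sup>2 + s * (1 + s) * (norm (y' - y))\<^sup>2"
    by (simp add: power2_norm_eq_inner algebra_simps inner_commute)
  then have "- s * \<epsilon> + s * (1 + s) * (norm (y' - y))\<^sup>2 / (2 * \<sigma>\<^sup>2) - (norm ((1 + s) *\<^sub>R y - s *\<^sub>R y'))\<^sup>2 / (2 * \<sigma>\<^sup>2)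
     = - (norm y)\<^sup>2 / (2 * \<sigma>\<^sup>2) + s * (- (norm y)\<^sup>2 / (2 * \<sigma>\<^sup>2) - (\<epsilon> + - (norm y')\<^sup>2 / (2 * \<sigma>\<^sup>2)))"
    using assms(1) by (simp only:) (simp add: field_simps)
  also have "\<dots> \<ge> - (norm y)\<^sup>2 / (2 * \<sigma>\<^sup>2)"
    using * assms(2) by simp
  finally have "C * exp (- (norm y)\<^sup>2 / (2 * \<sigma>\<^sup>2)) \<le> C * exp (- s * \<epsilon> + s * (1 + s) * (norm (y' - y))\<^sup>2 / (2 * \<sigma>\<^sup>2) -
      (norm ((1 + s) *\<^sub>R y - s *\<^sub>R y'))\<^sup>2 / (2 * \<sigma>\<^sup>2))"
    using C by simp
  also have "\<dots> = exp (- s * \<epsilon> + s * (1 + s) * (norm (v - v'))\<^sup>2 / (2 * \<sigma>\<^sup>2)) *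
      gaussian_density \<sigma> (x - (v + s *\<^sub>R (v - v')))"
    unfolding e(1) unfolding e(2) gaussian_density_def C_def[symmetric] by (simp add: exp_diff exp_add exp_minus field_simps)
  finally have "gaussian_density \<sigma> (x - v) \<le> exp (- s * \<epsilon> + s * (1 + s) * (norm (v - v'))\<^sup>2 / (2 * \<sigma>\<^sup>2)) *
      gaussian_density \<sigma> (x - (v + s *\<^sub>R (v - v')))"
    by (simp add: gaussian_density_def C_def y_def)
  then show ?thesis
    by (smt (verit) gaussian_density_nonneg exp_ge_zero mult_nonneg_nonneg)
qed

text \<open>Integrates the pointwise comparison, in which the tilted density has mass 1. The test is
  a function bounded by 1 instead of an event because averaging over later rounds turns an event
  into such a function of the current state.\<close>

lemma gaussian_mechanism:
  fixes v v' :: "'a::euclidean_space"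
  assumes [measurable]: "f \<in> borel_measurable borel" and f: "\<And>x. f x \<le> 1"
    and "\<sigma> > 0" "s \<ge> 0"
  shows "(\<integral>\<^sup>+x. f (v + x) \<partial>gaussian_noise \<sigma>) \<le> ennreal (exp \<epsilon>) * (\<integral>\<^sup>+x. f (v' + x) \<partial>gaussian_noise \<sigma>) +
    ennreal (exp (- s * \<epsilon> + s * (1 + s) * (norm (v - v'))\<^sup>2 / (2 * \<sigma>\<^sup>2)))"
proof -
  let ?g = "\<lambda>v x. ennreal (gaussian_density \<sigma> (x - v))"
  let ?c = "exp (- s * \<epsilon> + s * (1 + s) * (norm (v - v'))\<^sup>2 / (2 * \<sigma>\<^sup>2))"
  let ?u = "v + s *\<^sub>R (v - v')"
  have le: "?g v x \<le> ennreal (exp \<epsilon>) * ?g v' x + ennreal ?c * ?g ?u x" for x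
  proof -
    have "?g v x \<le> ennreal (exp \<epsilon> * gaussian_density \<sigma> (x - v') + ?c * gaussian_density \<sigma> (x - ?u))"
      using gaussian_density_le[OF assms(3,4), of x v \<epsilon> v'] by (intro ennreal_leI)
    also have "\<dots> = ennreal (exp \<epsilon>) * ?g v' x + ennreal ?c * ?g ?u x"
      by (subst ennreal_plus) (auto simp: ennreal_mult gaussian_density_nonneg)
    finally show ?thesis .
  qed
  have "(\<integral>\<^sup>+x. f (v + x) \<partial>gaussian_noise \<sigma>) = (\<integral>\<^sup>+x. ?g v x * f x \<partial>lborel)"
    by (rule nn_integral_gaussian_noise_shift) fact
  also have "\<dots> \<le> (\<integral>\<^sup>+x. ennreal (exp \<epsilon>) * (?g v' x * f x) + ennreal ?c * ?g ?u x \<partial>lborel)"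
  proof (rule nn_integral_mono)
    fix x
    have "?g v x * f x \<le> (ennreal (exp \<epsilon>) * ?g v' x + ennreal ?c * ?g ?u x) * f x"
      using le by (intro mult_right_mono) auto
    also have "\<dots> = ennreal (exp \<epsilon>) * (?g v' x * f x) + (ennreal ?c * ?g ?u x) * f x"
      by (simp add: distrib_right mult.assoc)
    also have "\<dots> \<le> ennreal (exp \<epsilon>) * (?g v' x * f x) + (ennreal ?c * ?g ?u x) * 1"
      using f by (intro add_left_mono mult_left_mono) auto
    finally show "?g v x * f x \<le> ennreal (exp \<epsilon>) * (?g v' x * f x) + ennreal ?c * ?g ?u x" by simp
  qed
  also have "\<dots> = ennreal (exp \<epsilon>) * (\<integral>\<^sup>+x. ?g v' x * f x \<partial>lborel) + ennreal ?c * (\<integral>\<^sup>+x. ?g ?u x \<partial>lborel)"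
    by (subst nn_integral_add) (auto simp: nn_integral_cmult)
  also have "(\<integral>\<^sup>+x. ?g ?u x \<partial>lborel) = (\<integral>\<^sup>+x. ennreal (gaussian_density \<sigma> (x::'a)) \<partial>lborel)"
    unfolding diff_conv_add_uminus[of _ ?u] 
    by (rule nn_integral_lborel_shift[of "\<lambda>x. ennreal (gaussian_density \<sigma> x)"]) simp
  also have "\<dots> = 1" by (rule nn_integral_gaussian_density) fact
  also have "(\<integral>\<^sup>+x. ?g v' x * f x \<partial>lborel) = (\<integral>\<^sup>+x. f (v' + x) \<partial>gaussian_noise \<sigma>)"
    by (rule nn_integral_gaussian_noise_shift[symmetric]) fact
  finally show ?thesis by simp
qed

text \<open>A form of Jensen's inequality, from the elementary bound
  \<open>t \<le> t\<^sup>2 / (2 * c) + c / 2\<close>, which is tight at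
  \<open>t = c\<close>.\<close>

lemma nn_integral_norm_le_of_square:
  assumes M: "prob_space M" and [measurable]: "f \<in> borel_measurable M" and "c > 0"
    and sq: "(\<integral>\<^sup>+x. ennreal ((norm (f x))\<^sup>2) \<partial>M) \<le> ennreal (c\<^sup>2)"
  shows "(\<integral>\<^sup>+x. ennreal (norm (f x)) \<partial>M) \<le> ennreal c"
proof -
  interpret prob_space M by fact
  have "ennreal (norm (f x)) \<le> ennreal (1 / (2 * c)) * ennreal ((norm (f x))\<^sup>2) + ennreal (c / 2)" for x
  proof -
    have "0 \<le> (norm (f x) - c)\<^sup>2 / (2 * c)" using \<open>c > 0\<close> by simp
    also have "\<dots> = 1 / (2 * c) * (norm (f x))\<^sup>2 + c / 2 - norm (f x)"
      using \<open>c > 0\<close> by (simp add: power2_eq_square field_simps)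
    finally have "norm (f x) \<le> 1 / (2 * c) * (norm (f x))\<^sup>2 + c / 2" by simp
    then show ?thesis
      using \<open>c > 0\<close> by (subst ennreal_mult[symmetric]) (auto simp flip: ennreal_plus intro!: ennreal_leI)
  qed
  then have "(\<integral>\<^sup>+x. ennreal (norm (f x)) \<partial>M) \<le>
      (\<integral>\<^sup>+x. ennreal (1 / (2 * c)) * ennreal ((norm (f x))\<^sup>2) + ennreal (c / 2) \<partial>M)"
    by (intro nn_integral_mono)
  also have "\<dots> = ennreal (1 / (2 * c)) * (\<integral>\<^sup>+x. ennreal ((norm (f x))\<^sup>2) \<partial>M) + ennreal (c / 2)"
    by (subst nn_integral_add) (auto simp: nn_integral_cmult emeasure_space_1)
  also have "\<dots> \<le> ennreal (1 / (2 * c)) * ennreal (c\<^sup>2) + ennreal (c / 2)"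
    by (intro add_right_mono mult_left_mono sq) simp
  also have "\<dots> = ennreal c"
    using \<open>c > 0\<close> by (subst ennreal_mult[symmetric])
      (auto simp flip: ennreal_plus simp: power2_eq_square)
  finally show ?thesis .
qed

lemma nn_integral_gaussian_noise_norm:
  assumes "\<sigma> > 0"
  shows "(\<integral>\<^sup>+x. ennreal (norm (x::'a::euclidean_space)) \<partial>gaussian_noise \<sigma>) \<le> ennreal (sqrt (real DIM('a)) * \<sigma>)"
proof (rule nn_integral_norm_le_of_square[OF prob_space_gaussian_noise[OF assms]])
  have coord: "(\<integral>\<^sup>+x. ennreal ((inner (x::'a) b)\<^sup>2) \<partial>gaussian_noise \<sigma>) = ennreal (\<sigma>\<^sup>2)" if b: "b \<in> Basis" for b
  proof -
    \<comment> \<open>The square is attached to coordinate \<open>b\<close> alone, so the integral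
      is a product of one-dimensional ones: the variance at \<open>b\<close> and total mass 1
      elsewhere.\<close>
    let ?f = "\<lambda>b' t. ennreal (normal_density 0 \<sigma> t) * (if b' = b then ennreal (t\<^sup>2) else 1)"
    have "(\<integral>\<^sup>+x. ennreal ((inner (x::'a) b)\<^sup>2) \<partial>gaussian_noise \<sigma>) =
        (\<integral>\<^sup>+x. (\<Prod>b'\<in>Basis. ennreal (normal_density 0 \<sigma> (inner (x::'a) b'))) * ennreal ((inner x b)\<^sup>2) \<partial>lborel)"
      unfolding gaussian_noise_def by (subst nn_integral_density) (auto simp: prod_ennreal)
    also have "\<dots> = (\<integral>\<^sup>+x. (\<Prod>b'\<in>Basis. ?f b' (inner (x::'a) b')) \<partial>lborel)"
      using b by (simp add: prod.distrib prod.delta)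
    also have "\<dots> = (\<Prod>b'\<in>Basis. \<integral>\<^sup>+t. ?f b' t \<partial>lborel)"
      by (subst nn_integral_lborel_prod) auto
    also have "\<dots> = (\<Prod>b'\<in>(Basis :: 'a set). if b' = b then ennreal (\<sigma>\<^sup>2) else 1)"
    proof (rule prod.cong[OF refl])
      fix b'
      have 1: "(\<integral>\<^sup>+x. ennreal (normal_density 0 \<sigma> x) \<partial>lborel) = 1"
        using assms by (subst nn_integral_eq_integral) auto
      have "(\<integral>\<^sup>+t. ennreal (normal_density 0 \<sigma> t) * ennreal (t\<^sup>2) \<partial>lborel) =
          (\<integral>\<^sup>+t. ennreal (normal_density 0 \<sigma> t * (t - 0) ^ (2 * 1)) \<partial>lborel)"
        by (simp add: ennreal_mult)
      also have "\<dots> = ennreal (fact (2 * 1) / ((2 / \<sigma>\<^sup>2) ^ 1 * fact 1))"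
        by (rule nn_integral_eq_integral[THEN trans], use normal_moment_even[OF assms, of 0 1] in
            \<open>simp_all only: has_bochner_integral_iff\<close>) simp
      also have "\<dots> = ennreal (\<sigma>\<^sup>2)" by (simp add: fact_numeral)
      finally show "(\<integral>\<^sup>+t. ?f b' t \<partial>lborel) = (if b' = b then ennreal (\<sigma>\<^sup>2) else 1)"
        using 1 by simp
    qed
    also have "\<dots> = ennreal (\<sigma>\<^sup>2)" using b by (simp add: prod.delta)
    finally show ?thesis .
  qed
  have "(\<integral>\<^sup>+x. ennreal ((norm (x::'a))\<^sup>2) \<partial>gaussian_noise \<sigma>) =
      (\<integral>\<^sup>+x. (\<Sum>b\<in>Basis. ennreal ((inner (x::'a) b)\<^sup>2)) \<partial>gaussian_noise \<sigma>)"
    by (simp add: norm_squared_eq_sum_Basis sum_ennreal)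
  also have "\<dots> = (\<Sum>b\<in>(Basis :: 'a set). ennreal (\<sigma>\<^sup>2))"
    by (subst nn_integral_sum) (auto simp: coord)
  also have "\<dots> = ennreal ((sqrt (real DIM('a)) * \<sigma>)\<^sup>2)"
    by (simp add: power_mult_distrib ennreal_mult ennreal_of_nat_eq_real_of_nat)
  finally show "(\<integral>\<^sup>+x. ennreal ((norm (x::'a))\<^sup>2) \<partial>gaussian_noise \<sigma>) \<le> ennreal ((sqrt (real DIM('a)) * \<sigma>)\<^sup>2)"
    by simp
qed (use assms in auto)

section \<open>Deviation of the sample mean\<close>

text \<open>The cross terms of centred independent summands vanish, so only the \<open>m\<close>
  diagonal terms survive in the second moment, which is at most
  \<open>L\<^sup>2 / m\<close>.\<close>

lemma nn_integral_sample_mean_deviation: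
  fixes h :: "'x \<Rightarrow> 'a::euclidean_space"
  assumes D: "prob_space D" and h[measurable]: "h \<in> borel_measurable D"
    and L: "\<And>x. x \<in> space D \<Longrightarrow> norm (h x) \<le> L" and "L > 0" "m > 0"
  shows "(\<integral>\<^sup>+S. ennreal (norm ((\<integral>x. h x \<partial>D) - (1 / real m) *\<^sub>R (\<Sum>j<m. h (S j))))
      \<partial>dataset_space m D) \<le> ennreal (L / sqrt (real m))"
proof -
  interpret D: prob_space D by fact
  interpret product_prob_space "\<lambda>_::nat. D" by unfold_locales
  let ?M = "dataset_space m D"
  interpret M: prob_space ?M by (rule prob_space_PiM) (rule D)
  define F where "F = (\<integral>x. h x \<partial>D)"
  define \<phi> where "\<phi> x = h x - F" for x
  have h_int: "integrable D h"
    using L by (intro D.integrable_const_bound[of _ L] AE_I2 h) auto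
  have \<phi>m[measurable]: "\<phi> \<in> borel_measurable D" unfolding \<phi>_def by measurable
  have F_le: "norm F \<le> L"
  proof -
    have "norm F \<le> (\<integral>x. norm (h x) \<partial>D)" unfolding F_def by (rule integral_norm_bound)
    also have "\<dots> \<le> (\<integral>x. L \<partial>D)" using L h_int by (intro integral_mono) auto
    finally show ?thesis by (simp add: D.prob_space)
  qed
  have \<phi>_le: "norm (\<phi> x) \<le> 2 * L" if "x \<in> space D" for x
    using L[OF that] F_le norm_triangle_ineq4[of "h x" F] by (simp add: \<phi>_def)
  have \<phi>b_le: "\<bar>inner (\<phi> x) b\<bar> \<le> 2 * L" if "x \<in> space D" "b \<in> Basis" for x b
    using \<phi>_le[OF that(1)] Basis_le_norm[OF that(2), of "\<phi> x"] by linarith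
  have \<phi>b_int: "integrable D (\<lambda>x. inner (\<phi> x) b)" if "b \<in> Basis" for b
    using \<phi>b_le that by (intro D.integrable_const_bound[of _ "2 * L"] AE_I2) auto
  have \<phi>_int: "integrable D \<phi>" unfolding \<phi>_def by (intro Bochner_Integration.integrable_diff h_int) auto
  have \<phi>b_0: "(\<integral>x. inner (\<phi> x) b \<partial>D) = 0" for b
    using h_int by (simp add: \<phi>_def inner_diff_left F_def D.prob_space)
  have \<phi>sq_int: "integrable D (\<lambda>x. (norm (\<phi> x))\<^sup>2)"
    using power_mono[OF \<phi>_le norm_ge_zero, where n = 2]
    by (intro D.integrable_const_bound[of _ "(2 * L)\<^sup>2"] AE_I2) auto
  \<comment> \<open>Centring only lowers the second moment, by the squared norm of the mean. This
    gives \<open>L\<^sup>2\<close> where the pointwise bound \<open>2 * L\<close> would give four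
    times as much.\<close>
  have diag: "(\<integral>x. (norm (\<phi> x))\<^sup>2 \<partial>D) \<le> L\<^sup>2"
  proof -
    have i1: "integrable D (\<lambda>x. (norm (h x))\<^sup>2)"
      using L by (intro D.integrable_const_bound[of _ "L\<^sup>2"] AE_I2) (auto intro!: power_mono)
    have i2: "integrable D (\<lambda>x. inner (h x) F)" using h_int by (rule integrable_inner_left)
    have "(norm (\<phi> x))\<^sup>2 = (norm (h x))\<^sup>2 - 2 * inner (h x) F + (norm F)\<^sup>2" for x
      by (simp add: \<phi>_def power2_norm_eq_inner algebra_simps inner_commute)
    then have "(\<integral>x. (norm (\<phi> x))\<^sup>2 \<partial>D) = (\<integral>x. (norm (h x))\<^sup>2 \<partial>D) - (norm F)\<^sup>2"
      using i1 i2 h_int by (simp add: D.prob_space F_def power2_norm_eq_inner)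
    also have "\<dots> \<le> (\<integral>x. (norm (h x))\<^sup>2 \<partial>D)" by simp
    also have "\<dots> \<le> (\<integral>x. L\<^sup>2 \<partial>D)" using L i1 by (intro integral_mono) (auto intro!: power_mono)
    finally show ?thesis by (simp add: D.prob_space)
  qed
  have comp[measurable]: "(\<lambda>S. \<phi> (S j)) \<in> borel_measurable ?M" if "j < m" for j
    using that by (intro measurable_compose[OF _ \<phi>m] measurable_component_singleton) auto
  have spM: "S j \<in> space D" if "S \<in> space ?M" "j < m" for S j
    using that by (auto simp: space_PiM)
  have int: "integrable ?M (\<lambda>S. inner (\<phi> (S j)) (\<phi> (S k)))" if "j < m" "k < m" for j k
  proof (rule M.integrable_const_bound[of _ "(2 * L) * (2 * L)"])
    show "AE S in ?M. norm (inner (\<phi> (S j)) (\<phi> (S k))) \<le> (2 * L) * (2 * L)"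
    proof (rule AE_I2)
      fix S assume S: "S \<in> space ?M"
      have "norm (inner (\<phi> (S j)) (\<phi> (S k))) \<le> norm (\<phi> (S j)) * norm (\<phi> (S k))"
        using Cauchy_Schwarz_ineq2[of "\<phi> (S j)" "\<phi> (S k)"] by simp
      also have "\<dots> \<le> (2 * L) * (2 * L)"
        using \<phi>_le[OF spM[OF S that(1)]] \<phi>_le[OF spM[OF S that(2)]] \<open>L > 0\<close> by (intro mult_mono) auto
      finally show "norm (inner (\<phi> (S j)) (\<phi> (S k))) \<le> (2 * L) * (2 * L)" .
    qed
  qed (use that in measurable)
  have off: "(\<integral>S. inner (\<phi> (S j)) (\<phi> (S k)) \<partial>?M) = 0" if jk: "j < m" "k < m" "j \<noteq> k" for j k
  proof -
    have *: "integrable ?M (\<lambda>S. inner (\<phi> (S j)) b * inner (\<phi> (S k)) b) \<and>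
        (\<integral>S. inner (\<phi> (S j)) b * inner (\<phi> (S k)) b \<partial>?M) = 0" if b: "b \<in> Basis" for b
    proof -
      \<comment> \<open>The constant 1 at all other indices lets the integral over the whole index
        set factorise; the factors at \<open>j\<close> and \<open>k\<close> have mean 0.\<close>
      define f where "f i x = (if i \<in> {j, k} then inner (\<phi> x) b else 1)" for i :: nat and x
      have f: "integrable D (f i)" for i
        unfolding f_def using \<phi>b_int[OF b] by (cases "i \<in> {j, k}") auto
      have eq: "(\<Prod>i<m. f i (S i)) = inner (\<phi> (S j)) b * inner (\<phi> (S k)) b" for S
      proof -
        have "(\<Prod>i<m. f i (S i)) = (\<Prod>i\<in>{j, k}. f i (S i))"
          using jk by (intro prod.mono_neutral_right) (auto simp: f_def)
        then show ?thesis using jk by (simp add: f_def)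
      qed
      have "integrable ?M (\<lambda>S. \<Prod>i<m. f i (S i))"
        by (rule product_integrable_prod) (auto simp: f)
      moreover have "(\<integral>S. (\<Prod>i<m. f i (S i)) \<partial>?M) = (\<Prod>i<m. \<integral>x. f i x \<partial>D)"
        by (rule product_integral_prod) (auto simp: f)
      moreover have "(\<Prod>i<m. \<integral>x. f i x \<partial>D) = 0"
        using jk \<phi>b_0[of b] by (intro prod_zero) (auto simp: f_def intro!: bexI[of _ j])
      ultimately show ?thesis by (simp add: eq)
    qed
    have "(\<integral>S. inner (\<phi> (S j)) (\<phi> (S k)) \<partial>?M) =
        (\<integral>S. (\<Sum>b\<in>Basis. inner (\<phi> (S j)) b * inner (\<phi> (S k)) b) \<partial>?M)"
      by (subst euclidean_inner) simp
    also have "\<dots> = 0"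
      using * by (subst Bochner_Integration.integral_sum) auto
    finally show ?thesis .
  qed
  have on: "(\<integral>S. inner (\<phi> (S j)) (\<phi> (S j)) \<partial>?M) \<le> L\<^sup>2" if "j < m" for j
  proof -
    have "(\<integral>S. inner (\<phi> (S j)) (\<phi> (S j)) \<partial>?M) = (\<integral>x. inner (\<phi> x) (\<phi> x) \<partial>distr ?M D (\<lambda>S. S j))"
      using that by (subst integral_distr) auto
    also have "distr ?M D (\<lambda>S. S j) = D"
      using that D by (intro distr_PiM_component) auto
    finally show ?thesis using diag by (simp add: power2_norm_eq_inner)
  qed
  define f where "f S = F - (1 / real m) *\<^sub>R (\<Sum>j<m. h (S j))" for S
  have f_eq: "(norm (f S))\<^sup>2 = 1 / (real m)\<^sup>2 * (\<Sum>j<m. \<Sum>k<m. inner (\<phi> (S j)) (\<phi> (S k)))" for S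
  proof -
    have "f S = - ((1 / real m) *\<^sub>R (\<Sum>j<m. \<phi> (S j)))"
      using \<open>m > 0\<close> by (simp add: f_def \<phi>_def sum_subtractf algebra_simps sum_constant_scaleR)
    moreover have "(norm (\<Sum>j<m. \<phi> (S j)))\<^sup>2 = (\<Sum>j<m. \<Sum>k<m. inner (\<phi> (S j)) (\<phi> (S k)))"
      by (simp only: power2_norm_eq_inner inner_sum_left inner_sum_right) (rule sum.swap)
    ultimately show ?thesis by (simp add: power_divide)
  qed
  have f_int: "integrable ?M (\<lambda>S. (norm (f S))\<^sup>2)"
    unfolding f_eq by (intro Bochner_Integration.integrable_mult_right Bochner_Integration.integrable_sum int) auto
  have sum2: "(\<integral>S. (\<Sum>j<m. \<Sum>k<m. inner (\<phi> (S j)) (\<phi> (S k))) \<partial>?M) =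
      (\<Sum>j<m. \<Sum>k<m. \<integral>S. inner (\<phi> (S j)) (\<phi> (S k)) \<partial>?M)"
  proof -
    have "(\<integral>S. (\<Sum>j<m. \<Sum>k<m. inner (\<phi> (S j)) (\<phi> (S k))) \<partial>?M) =
        (\<Sum>j<m. \<integral>S. (\<Sum>k<m. inner (\<phi> (S j)) (\<phi> (S k))) \<partial>?M)"
      by (intro Bochner_Integration.integral_sum Bochner_Integration.integrable_sum int) auto
    also have "\<dots> = (\<Sum>j<m. \<Sum>k<m. \<integral>S. inner (\<phi> (S j)) (\<phi> (S k)) \<partial>?M)"
      by (intro sum.cong refl Bochner_Integration.integral_sum int) auto
    finally show ?thesis .
  qed
  have "(\<integral>S. (norm (f S))\<^sup>2 \<partial>?M) = 1 / (real m)\<^sup>2 * (\<Sum>j<m. \<Sum>k<m. \<integral>S. inner (\<phi> (S j)) (\<phi> (S k)) \<partial>?M)"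
    unfolding f_eq by (simp add: sum2)
  also have "(\<Sum>j<m. \<Sum>k<m. \<integral>S. inner (\<phi> (S j)) (\<phi> (S k)) \<partial>?M) \<le> (\<Sum>j<m. \<Sum>k<m. if k = j then L\<^sup>2 else 0)"
    using on off by (intro sum_mono) auto
  also have "\<dots> = real m * L\<^sup>2" by (simp add: sum.delta)
  also have "1 / (real m)\<^sup>2 * (real m * L\<^sup>2) = (L / sqrt (real m))\<^sup>2"
    using \<open>m > 0\<close> by (simp add: power_divide power2_eq_square field_simps)
  finally have le: "(\<integral>S. (norm (f S))\<^sup>2 \<partial>?M) \<le> (L / sqrt (real m))\<^sup>2"
    by (simp add: divide_right_mono mult_left_mono)
  have "(\<integral>\<^sup>+S. ennreal (norm (f S)) \<partial>?M) \<le> ennreal (L / sqrt (real m))"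
  proof (rule nn_integral_norm_le_of_square)
    show "f \<in> borel_measurable ?M"
    proof -
      have "(\<lambda>S. h (S j)) \<in> borel_measurable ?M" if "j < m" for j
        using that by (intro measurable_compose[OF _ h] measurable_component_singleton) auto
      then show ?thesis unfolding f_def by measurable
    qed
    show "(\<integral>\<^sup>+S. ennreal ((norm (f S))\<^sup>2) \<partial>?M) \<le> ennreal ((L / sqrt (real m))\<^sup>2)"
      using le f_int by (subst nn_integral_eq_integral) (auto intro!: ennreal_leI)
  qed (use \<open>L > 0\<close> \<open>m > 0\<close> M.prob_space_axioms in auto)
  then show ?thesis by (simp add: f_def F_def)
qed

section \<open>Privacy of a noisy estimate\<close>

text \<open>With \<Delta> the sensitivity of the exact equilibrium, the means may be
  \<open>2 * \<Delta>\<close> apart, which leaves \<Delta> for the errors of both solver runs;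
  likewise only half of \<delta> is spent here.\<close>

lemma gaussian_privacy:
  fixes v v' :: "'a::euclidean_space"
  assumes "f \<in> borel_measurable borel" "\<And>x. f x \<le> 1"
    and "\<epsilon> > 0" "0 < \<delta>" "\<delta> < 1" "\<epsilon> \<le> 2 * ln (2 / \<delta>)" "\<Delta> > 0"
    and \<sigma>: "\<sigma> = 4 * \<Delta> * sqrt (ln (2 / \<delta>)) / \<epsilon>" and v: "norm (v - v') \<le> 2 * \<Delta>"
  shows "(\<integral>\<^sup>+x. f (v + x) \<partial>gaussian_noise \<sigma>) \<le>
    ennreal (exp \<epsilon>) * (\<integral>\<^sup>+x. f (v' + x) \<partial>gaussian_noise \<sigma>) + ennreal (\<delta> / 2)"
proof -
  define l where "l = ln (2 / \<delta>)"
  have l: "l > 0" unfolding l_def using assms by (simp add: ln_gt_zero)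
  have "\<sigma> > 0" using l assms by (simp add: \<sigma> l_def)
  \<comment> \<open>This choice makes the linear term \<open>- 2 * l\<close>. With the given
    \<sigma> the quadratic term is \<open>\<epsilon> / 4 + l / 2\<close>, which is at most
    \<open>l\<close> exactly when \<open>\<epsilon> \<le> 2 * l\<close>; the exponent is then at
    most \<open>- l\<close>.\<close>
  define s where "s = 2 * l / \<epsilon>"
  have s: "s \<ge> 0" using l assms by (simp add: s_def)
  have "(norm (v - v'))\<^sup>2 / (2 * \<sigma>\<^sup>2) \<le> (2 * \<Delta>)\<^sup>2 / (2 * \<sigma>\<^sup>2)"
    using v by (intro divide_right_mono power_mono) auto
  also have "\<dots> = \<epsilon>\<^sup>2 / (8 * l)"
    using l assms(3,7) unfolding \<sigma> l_def[symmetric] by (simp add: power_mult_distrib power_divide field_simps)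
  finally have "s * (1 + s) * ((norm (v - v'))\<^sup>2 / (2 * \<sigma>\<^sup>2)) \<le> s * (1 + s) * (\<epsilon>\<^sup>2 / (8 * l))"
    using s by (intro mult_left_mono) auto
  also have "\<dots> = \<epsilon> / 4 + l / 2"
    using l assms(3) by (simp add: s_def field_simps power2_eq_square)
  also have "\<dots> \<le> l" using assms(6) by (simp add: l_def)
  finally have "- s * \<epsilon> + s * (1 + s) * (norm (v - v'))\<^sup>2 / (2 * \<sigma>\<^sup>2) \<le> - l"
    using assms(3) by (simp add: s_def)
  then have "exp (- s * \<epsilon> + s * (1 + s) * (norm (v - v'))\<^sup>2 / (2 * \<sigma>\<^sup>2)) \<le> exp (- l)"
    by simp
  also have "\<dots> = \<delta> / 2" using assms by (simp add: l_def exp_minus)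
  finally have "ennreal (exp (- s * \<epsilon> + s * (1 + s) * (norm (v - v'))\<^sup>2 / (2 * \<sigma>\<^sup>2))) \<le> ennreal (\<delta> / 2)"
    by (rule ennreal_leI)
  with gaussian_mechanism[OF assms(1,2) \<open>\<sigma> > 0\<close> s, of v \<epsilon> v'] show ?thesis
    by (meson add_left_mono order_trans)
qed

text \<open>The two runs are coupled independently; \<open>f \<le> 1\<close> turns the expected distances to the
  deterministic points \<open>z\<close> and \<open>z'\<close> into a contribution to \<open>\<delta>\<close>.\<close>

lemma noisy_output_privacy:
  fixes z z' :: "'a::euclidean_space"
  assumes W: "prob_space W" and f[measurable]: "f \<in> borel_measurable borel" and f1: "\<And>x. f x \<le> 1"
    and a[measurable]: "a \<in> borel_measurable W" "a' \<in> borel_measurable W"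
    and le: "(\<integral>\<^sup>+\<omega>. ennreal (norm (z - a \<omega>)) \<partial>W) \<le> ennreal (\<delta> * \<Delta> / 10)"
      "(\<integral>\<^sup>+\<omega>. ennreal (norm (z' - a' \<omega>)) \<partial>W) \<le> ennreal (\<delta> * \<Delta> / 10)"
    and par: "\<epsilon> > 0" "0 < \<delta>" "\<delta> < 1" "\<epsilon> \<le> 2 * ln (2 / \<delta>)" "\<Delta> > 0"
    and \<sigma>: "\<sigma> = 4 * \<Delta> * sqrt (ln (2 / \<delta>)) / \<epsilon>" and z: "norm (z - z') \<le> \<Delta>"
  shows "(\<integral>\<^sup>+\<omega>. (\<integral>\<^sup>+x. f (a \<omega> + x) \<partial>gaussian_noise \<sigma>) \<partial>W) \<le>
    ennreal (exp \<epsilon>) * (\<integral>\<^sup>+\<omega>. (\<integral>\<^sup>+x. f (a' \<omega> + x) \<partial>gaussian_noise \<sigma>) \<partial>W) + ennreal \<delta>"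
proof -
  interpret W: prob_space W by fact
  have "ln (2 / \<delta>) > 0" using par by (simp add: ln_gt_zero)
  then have "\<sigma> > 0" using par by (simp add: \<sigma>)
  then interpret N: prob_space "gaussian_noise \<sigma> :: 'a measure" by (rule prob_space_gaussian_noise)
  define \<Phi> where "\<Phi> v = (\<integral>\<^sup>+x. f (v + x) \<partial>gaussian_noise \<sigma>)" for v :: 'a
  have \<Phi>m[measurable]: "\<Phi> \<in> borel_measurable borel"
    unfolding \<Phi>_def by (rule N.borel_measurable_nn_integral) measurable
  have \<Phi>1: "\<Phi> v \<le> 1" for v
  proof -
    have "\<Phi> v \<le> (\<integral>\<^sup>+x. 1 \<partial>(gaussian_noise \<sigma> :: 'a measure))" unfolding \<Phi>_def by (intro nn_integral_mono f1)
    then show ?thesis using N.emeasure_space_1 by simp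
  qed
  have pw: "\<Phi> (a \<omega>) \<le> ennreal (exp \<epsilon>) * \<Phi> (a' \<omega>') + ennreal (\<delta> / 2) +
      ennreal (1 / \<Delta>) * (ennreal (norm (z - a \<omega>)) + ennreal (norm (z' - a' \<omega>')))" for \<omega> \<omega>'
  proof (cases "norm (z - a \<omega>) + norm (z' - a' \<omega>') \<ge> \<Delta>")
    case True
    then have "1 \<le> 1 / \<Delta> * (norm (z - a \<omega>) + norm (z' - a' \<omega>'))"
      using par by (simp add: field_simps)
    then have "ennreal 1 \<le> ennreal (1 / \<Delta> * (norm (z - a \<omega>) + norm (z' - a' \<omega>')))"
      by (rule ennreal_leI)
    also have "\<dots> = ennreal (1 / \<Delta>) * (ennreal (norm (z - a \<omega>)) + ennreal (norm (z' - a' \<omega>')))"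
      using par by (subst ennreal_mult) auto
    finally have "1 \<le> ennreal (1 / \<Delta>) * (ennreal (norm (z - a \<omega>)) + ennreal (norm (z' - a' \<omega>')))" by simp
    from order_trans[OF \<Phi>1 this] show ?thesis by (rule add_increasing[OF zero_le])
  next
    case False
    have "a \<omega> - a' \<omega>' = (z - z') - (z - a \<omega>) + (z' - a' \<omega>')" by simp
    then have "norm (a \<omega> - a' \<omega>') \<le> norm (z - z') + norm (z - a \<omega>) + norm (z' - a' \<omega>')"
      by (metis norm_triangle_le norm_triangle_ineq4 add_mono order_refl)
    then have "norm (a \<omega> - a' \<omega>') \<le> 2 * \<Delta>" using False z by linarith
    from gaussian_privacy[OF f f1 par \<sigma> this] show ?thesis
      unfolding \<Phi>_def by (rule add_increasing2[OF zero_le])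
  qed
  let ?K = "ennreal (exp \<epsilon>) * (\<integral>\<^sup>+\<omega>'. \<Phi> (a' \<omega>') \<partial>W) + ennreal (\<delta> / 2)"
  have "(\<integral>\<^sup>+\<omega>. \<Phi> (a \<omega>) \<partial>W) = (\<integral>\<^sup>+\<omega>. (\<integral>\<^sup>+\<omega>'. \<Phi> (a \<omega>) \<partial>W) \<partial>W)"
    by (simp add: W.emeasure_space_1)
  also have "\<dots> \<le> (\<integral>\<^sup>+\<omega>. (\<integral>\<^sup>+\<omega>'. ennreal (exp \<epsilon>) * \<Phi> (a' \<omega>') + ennreal (\<delta> / 2) +
      ennreal (1 / \<Delta>) * (ennreal (norm (z - a \<omega>)) + ennreal (norm (z' - a' \<omega>'))) \<partial>W) \<partial>W)"
    by (intro nn_integral_mono pw)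
  also have "\<dots> = (\<integral>\<^sup>+\<omega>. ?K + ennreal (1 / \<Delta>) * (ennreal (norm (z - a \<omega>)) + (\<integral>\<^sup>+\<omega>'. ennreal (norm (z' - a' \<omega>')) \<partial>W)) \<partial>W)"
    by (intro nn_integral_cong) (simp add: nn_integral_add nn_integral_cmult W.emeasure_space_1)
  also have "\<dots> = ?K + ennreal (1 / \<Delta>) * ((\<integral>\<^sup>+\<omega>. ennreal (norm (z - a \<omega>)) \<partial>W) + (\<integral>\<^sup>+\<omega>'. ennreal (norm (z' - a' \<omega>')) \<partial>W))"
    by (simp add: nn_integral_add nn_integral_cmult W.emeasure_space_1)
  also have "\<dots> \<le> ?K + ennreal (1 / \<Delta>) * (ennreal (\<delta> * \<Delta> / 10) + ennreal (\<delta> * \<Delta> / 10))"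
    by (intro add_left_mono mult_left_mono add_mono le) auto
  \<comment> \<open>The budget: \<open>\<delta> / 2\<close> for the Gaussian tail and
    \<open>\<delta> / 10\<close> for each of the two solver runs, together below \<delta>.\<close>
  also have "\<dots> = ennreal (exp \<epsilon>) * (\<integral>\<^sup>+\<omega>'. \<Phi> (a' \<omega>') \<partial>W) + (ennreal (\<delta> / 2) + ennreal (\<delta> / 5))"
    using par by (simp flip: ennreal_plus ennreal_mult add: add.assoc)
  also have "\<dots> \<le> ennreal (exp \<epsilon>) * (\<integral>\<^sup>+\<omega>'. \<Phi> (a' \<omega>') \<partial>W) + ennreal \<delta>"
    using par by (intro add_left_mono) (simp flip: ennreal_plus)
  finally show ?thesis by (simp add: \<Phi>_def)
qed

section \<open>Recursive regularization\<close>

definition empirical_operator ::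
    "nat \<Rightarrow> ('a::euclidean_space \<Rightarrow> 'x \<Rightarrow> 'a) \<Rightarrow> (nat \<Rightarrow> 'x) \<Rightarrow> 'a \<Rightarrow> 'a" where
  "empirical_operator m g b u = (1 / real m) *\<^sub>R (\<Sum>j<m. g u (b j))"

text \<open>No distribution of the data appears here: privacy and the evaluation count hold for
  every dataset. The batch size and the number of rounds stay abstract until the rates are
  computed.\<close>

locale recursive_regularization =
  fixes X :: "'x measure"
    and Z :: "'a::euclidean_space set"
    and g :: "'a \<Rightarrow> 'x \<Rightarrow> 'a"
    and n m T :: nat
    and L \<beta> B \<epsilon> \<delta> lam c c\<^sub>0 :: real
    and idx :: "nat \<Rightarrow> nat \<Rightarrow> nat"
    and W :: "nat \<Rightarrow> 'w measure"
    and P :: "nat \<Rightarrow> 'w \<Rightarrow> (nat \<Rightarrow> 'x) \<Rightarrow> ('a \<Rightarrow> 'a) \<Rightarrow> ('a, 'x, 'a) grad_prog"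
    and z\<^sub>0 :: 'a
  assumes compact_Z: "compact Z" and convex_Z: "convex Z" and diameter_Z: "diameter Z = B"
    and B_pos: "B > 0" and operator: "svi_operator X Z g L \<beta>" and L_pos: "L > 0"
    and eps_pos: "\<epsilon> > 0" and delta_pos: "0 < \<delta>" and delta_less: "\<delta> < 1"
    and lam_pos: "lam > 0" and m_pos: "m > 0" and c_pos: "c > 0"
    and z0_in: "z\<^sub>0 \<in> Z" and batches: "disjoint_batches n T m idx"
    and solver: "\<And>t. t \<in> {1..T} \<Longrightarrow>
      accelerated_solver c c\<^sub>0 X Z g \<beta> m (2 ^ t * lam) (solver_K c L B lam m \<delta> t) (W t) (P t)"
begin

abbreviation "sdev \<equiv> noise_scale L lam m \<epsilon> \<delta>"

text \<open>After \<open>t\<close> rounds the accumulated regularizer is \<open>u \<mapsto> coef t (u - w)\<close>, where the centre \<open>w\<close> is a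
  weighted mean of the points visited so far; a state is the current point together with \<open>w\<close>.\<close>

definition coef :: "nat \<Rightarrow> real" where
  "coef t = (2 ^ (t + 2) - 2) * lam"

definition centre :: "nat \<Rightarrow> 'a \<Rightarrow> 'a \<Rightarrow> 'a" where
  "centre t w z = (1 / coef (Suc t)) *\<^sub>R (coef t *\<^sub>R w + (2 ^ (t + 2) * lam) *\<^sub>R z)"

definition solve :: "nat \<Rightarrow> (nat \<Rightarrow> 'x) \<Rightarrow> 'a \<Rightarrow> 'w \<Rightarrow> 'a" where
  "solve t b w \<omega> = run g (P (Suc t) \<omega> b (\<lambda>u. coef t *\<^sub>R (u - w)))"

definition step :: "nat \<Rightarrow> (nat \<Rightarrow> 'x) \<Rightarrow> 'a \<times> 'a \<Rightarrow> 'w \<times> 'a \<Rightarrow> 'a \<times> 'a" where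
  "step t b s y = (solve t b (snd s) (fst y) + snd y,
     centre t (snd s) (solve t b (snd s) (fst y) + snd y))"

primrec state :: "(nat \<Rightarrow> 'x) \<Rightarrow> (nat \<Rightarrow> 'w \<times> 'a) \<Rightarrow> nat \<Rightarrow> 'a \<times> 'a" where
  "state S \<rho> 0 = (z\<^sub>0, z\<^sub>0)"
| "state S \<rho> (Suc t) = step t (batch m idx (Suc t) S) (state S \<rho> t) (\<rho> (Suc t))"

text \<open>\<open>coef t\<close> is the geometric sum
  \<open>2 * lam + 4 * lam + ... + 2 ^ (t + 1) * lam\<close>. Its last term is already the strong
  monotonicity parameter with which the solver is called in round \<open>t + 1\<close>.\<close>

lemma coef_ge: "2 ^ Suc t * lam \<le> coef t"
proof -
  have "(2::real) ^ Suc t \<le> 2 ^ (t + 2) - 2" by simp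
  then show ?thesis unfolding coef_def using lam_pos by (intro mult_right_mono) auto
qed

lemma coef_pos: "coef t > 0"
  using coef_ge[of t] lam_pos by (smt (verit) zero_less_power mult_pos_pos)

lemma strongly_monotone_regularizer:
  "strongly_monotone_on (2 ^ Suc t * lam) Z (\<lambda>u. coef t *\<^sub>R (u - w))"
proof -
  have "monotone_operator_on Z (\<lambda>u. 0::'a)" by (simp add: monotone_operator_on_def)
  from strongly_monotone_on_add[OF this coef_ge] show ?thesis by simp
qed

lemma coef_Suc: "coef (Suc t) = coef t + 2 ^ (t + 2) * lam"
  by (simp add: coef_def algebra_simps)

text \<open>Two quadratic penalties add up to one around the weighted mean of their centres. This
  keeps the regularizer in the shape \<open>a *\<^sub>R (z - w)\<close>, for which the solver is
  jointly measurable in its seed, the centre and the data.\<close>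

lemma coef_centre: "coef (Suc t) *\<^sub>R (u - centre t w z) = coef t *\<^sub>R (u - w) + (2 ^ (t + 2) * lam) *\<^sub>R (u - z)"
proof -
  have "coef (Suc t) *\<^sub>R (u - centre t w z) = coef (Suc t) *\<^sub>R u - (coef t *\<^sub>R w + (2 ^ (t + 2) * lam) *\<^sub>R z)"
    using coef_pos[of "Suc t"] by (simp add: centre_def algebra_simps)
  then show ?thesis by (simp add: coef_Suc algebra_simps)
qed

lemma idx_inj:
  assumes "idx k j = idx k' j'" "k \<in> {1..T}" "k' \<in> {1..T}" "j < m" "j' < m"
  shows "k = k' \<and> j = j'"
  using batches assms inj_onD[of "\<lambda>(t, j). idx t j" "{1..T} \<times> {..<m}" "(k, j)" "(k', j')"]
  by (simp add: disjoint_batches_def)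

lemma idx_less: "k \<in> {1..T} \<Longrightarrow> j < m \<Longrightarrow> idx k j < n"
  using batches by (auto simp: disjoint_batches_def)

text \<open>Replaces the operator carried along by the program with its centre, so that a state
  becomes a pair of vectors and measurability of the state makes sense.\<close>

lemma run_R_SVI_state:
  "run g (R_SVI_state lam m idx P z\<^sub>0 S \<rho> t) =
     (fst (state S \<rho> t), \<lambda>u. coef t *\<^sub>R (u - snd (state S \<rho> t)))"
proof (induction t)
  case 0
  then show ?case by (simp add: coef_def)
next
  case (Suc t)
  show ?case
    by (simp add: run_and_then Suc A_emp_def step_def solve_def coef_centre split_beta)
qed

lemma run_R_SVI: "run g (R_SVI lam T m idx P z\<^sub>0 S \<rho>) = fst (state S \<rho> T)"
  by (simp add: R_SVI_def run_and_then run_R_SVI_state)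

text \<open>The causality of the recursion. All independence of a round from its past is derived
  from it, for the noise as well as for the data.\<close>

lemma state_cong:
  assumes "\<And>k. k \<in> {1..t} \<Longrightarrow> \<rho> k = \<rho>' k"
    and "\<And>k. k \<in> {1..t} \<Longrightarrow> batch m idx k S = batch m idx k S'"
  shows "state S \<rho> t = state S' \<rho>' t"
  using assms by (induction t) auto

subsection \<open>Measurability\<close>

lemma prob_space_W: "t \<in> {1..T} \<Longrightarrow> prob_space (W t)"
  using solver by (simp add: accelerated_solver_def)

lemma sdev_pos: "sdev t > 0"
  using L_pos lam_pos m_pos eps_pos delta_pos delta_less
  by (simp add: noise_scale_def ln_gt_zero)

text \<open>The seeds of the rounds beyond \<open>T\<close> are irrelevant; they are made trivial so that every
  factor is a probability space.\<close>

definition noise :: "nat \<Rightarrow> ('w \<times> 'a) measure" where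
  "noise t = (if t \<in> {1..T} then W t \<Otimes>\<^sub>M gaussian_noise (sdev t) else return (count_space UNIV) undefined)"

abbreviation "randomness \<equiv> Pi\<^sub>M {1..T} noise"

lemma randomness_eq: "R_SVI_randomness T W sdev = randomness"
  unfolding R_SVI_randomness_def by (rule PiM_cong) (auto simp: noise_def)

lemma prob_space_noise: "prob_space (noise t)"
proof (cases "t \<in> {1..T}")
  case True
  interpret W: prob_space "W t" using True by (rule prob_space_W)
  interpret N: prob_space "gaussian_noise (sdev t) :: 'a measure"
    by (rule prob_space_gaussian_noise[OF sdev_pos])
  interpret pair_prob_space "W t" "gaussian_noise (sdev t) :: 'a measure" ..
  show ?thesis using True by (simp add: noise_def prob_space_axioms)
next
  case False
  then show ?thesis unfolding noise_def by (simp only: if_False) (rule prob_space_return, simp)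
qed

lemmas noise_total = prob_space.emeasure_space_1[OF prob_space_noise]
lemmas noise_borel_measurable_nn_integral =
  sigma_finite_measure.borel_measurable_nn_integral[OF prob_space_imp_sigma_finite[OF prob_space_noise]]

sublocale noise: product_prob_space noise
  by (intro product_prob_spaceI prob_space_noise)

sublocale randomness: prob_space randomness
  by (intro prob_space_PiM prob_space_noise)

lemma noise_Suc: "Suc t \<le> T \<Longrightarrow> noise (Suc t) = W (Suc t) \<Otimes>\<^sub>M gaussian_noise (sdev (Suc t))"
  by (simp add: noise_def)

lemma measurable_solve:
  assumes "Suc t \<le> T"
  shows "(\<lambda>((\<omega>, w), b). solve t b w \<omega>) \<in> borel_measurable ((W (Suc t) \<Otimes>\<^sub>M borel) \<Otimes>\<^sub>M dataset_space m X)"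
proof -
  have "coef t \<ge> 2 ^ Suc t * lam" by (rule coef_ge)
  with solver[of "Suc t"] assms show ?thesis
    unfolding accelerated_solver_def solve_def by simp
qed

lemma measurable_solve':
  assumes "Suc t \<le> T" and [measurable]: "f \<in> M \<rightarrow>\<^sub>M dataset_space m X" "h \<in> M \<rightarrow>\<^sub>M borel" "k \<in> M \<rightarrow>\<^sub>M W (Suc t)"
  shows "(\<lambda>x. solve t (f x) (h x) (k x)) \<in> borel_measurable M"
proof -
  have "(\<lambda>x. ((k x, h x), f x)) \<in> M \<rightarrow>\<^sub>M (W (Suc t) \<Otimes>\<^sub>M borel) \<Otimes>\<^sub>M dataset_space m X"
    by measurable
  from measurable_compose[OF this measurable_solve[OF assms(1)]] show ?thesis by simp
qed

lemma measurable_centre [measurable (raw)]: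
  assumes [measurable]: "f \<in> borel_measurable M" "h \<in> borel_measurable M"
  shows "(\<lambda>x. centre t (f x) (h x)) \<in> borel_measurable M"
  unfolding centre_def by measurable

lemma measurable_step:
  assumes t: "Suc t \<le> T" and f[measurable]: "f \<in> M \<rightarrow>\<^sub>M dataset_space m X" and h[measurable]: "h \<in> M \<rightarrow>\<^sub>M borel \<Otimes>\<^sub>M borel"
    and k: "k \<in> M \<rightarrow>\<^sub>M noise (Suc t)"
  shows "(\<lambda>x. step t (f x) (h x) (k x)) \<in> M \<rightarrow>\<^sub>M borel \<Otimes>\<^sub>M borel"
proof -
  have k'[measurable]: "k \<in> M \<rightarrow>\<^sub>M W (Suc t) \<Otimes>\<^sub>M (borel :: 'a measure)"
    using k unfolding noise_Suc[OF t]
    by (subst measurable_cong_sets[OF refl sets_pair_measure_cong[OF refl sets_gaussian_noise[symmetric]]])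
  have [measurable]: "(\<lambda>x. solve t (f x) (snd (h x)) (fst (k x))) \<in> borel_measurable M"
    by (rule measurable_solve'[OF t]) measurable
  show ?thesis unfolding step_def by measurable
qed

lemma measurable_batch:
  assumes t: "t \<in> {1..T}" and f[measurable]: "f \<in> M \<rightarrow>\<^sub>M dataset_space n X"
  shows "(\<lambda>x. batch m idx t (f x)) \<in> M \<rightarrow>\<^sub>M dataset_space m X"
proof -
  show ?thesis unfolding batch_def using t
    by (intro measurable_restrict measurable_compose[OF f] measurable_component_singleton) (auto simp: idx_less)
qed

lemma measurable_state:
  assumes "t \<le> T" and [measurable]: "f \<in> M \<rightarrow>\<^sub>M dataset_space n X" "h \<in> M \<rightarrow>\<^sub>M randomness"
  shows "(\<lambda>x. state (f x) (h x) t) \<in> M \<rightarrow>\<^sub>M borel \<Otimes>\<^sub>M borel"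
  using assms(1)
proof (induction t)
  case 0
  then show ?case by simp
next
  case (Suc t)
  have "(\<lambda>x. h x (Suc t)) \<in> M \<rightarrow>\<^sub>M noise (Suc t)"
    using Suc.prems by (intro measurable_compose[OF assms(3)] measurable_component_singleton) auto
  with Suc show ?case by (simp add: measurable_step measurable_batch assms(2))
qed

lemma measurable_state_fixed:
  assumes "t \<le> T" "S \<in> space (dataset_space n X)"
  shows "(\<lambda>\<rho>. state S \<rho> t) \<in> randomness \<rightarrow>\<^sub>M borel \<Otimes>\<^sub>M borel"
  by (rule measurable_state[where f = "\<lambda>_. S" and h = "\<lambda>\<rho>. \<rho>"])
    (simp_all add: assms measurable_ident_sets measurable_const)

lemma batch_in_space:
  assumes "S \<in> space (dataset_space n X)" "t \<in> {1..T}"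
  shows "batch m idx t S \<in> space (dataset_space m X)"
  using measurable_space[OF measurable_batch[OF assms(2) measurable_ident] assms(1)] by simp

text \<open>Both sides reduce to the same integral over the other coordinates:
  \<open>state S \<rho> t\<close> ignores coordinate \<open>Suc t\<close>, which is integrated out
  on the left and is a dummy of total mass 1 on the right. In effect the noise of a round is drawn
  afresh, independently of the state before it.\<close>

lemma nn_integral_resample_noise:
  assumes t: "Suc t \<le> T" and S: "S \<in> space (dataset_space n X)"
    and F: "(\<lambda>(s, y). F s y) \<in> borel_measurable ((borel \<Otimes>\<^sub>M borel) \<Otimes>\<^sub>M noise (Suc t))"
  shows "(\<integral>\<^sup>+\<rho>. F (state S \<rho> t) (\<rho> (Suc t)) \<partial>randomness) =
    (\<integral>\<^sup>+\<rho>. (\<integral>\<^sup>+y. F (state S \<rho> t) y \<partial>noise (Suc t)) \<partial>randomness)"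
proof -
  define I where "I = {1..T} - {Suc t}"
  have I: "{1..T} = insert (Suc t) I" "finite I" "Suc t \<notin> I" using t by (auto simp: I_def)
  have st[measurable]: "(\<lambda>\<rho>. state S \<rho> t) \<in> randomness \<rightarrow>\<^sub>M borel \<Otimes>\<^sub>M borel"
    using t by (intro measurable_state_fixed S) simp
  have comp[measurable]: "(\<lambda>\<rho>. \<rho> (Suc t)) \<in> randomness \<rightarrow>\<^sub>M noise (Suc t)"
    using t by (intro measurable_component_singleton) auto
  have F1: "(\<lambda>\<rho>. F (state S \<rho> t) (\<rho> (Suc t))) \<in> borel_measurable randomness"
    using measurable_compose[OF measurable_Pair[OF st comp] F] by simp
  have F2: "(\<lambda>\<rho>. \<integral>\<^sup>+y. F (state S \<rho> t) y \<partial>noise (Suc t)) \<in> borel_measurable randomness"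
    using noise_borel_measurable_nn_integral[OF F] by (intro measurable_compose[OF st]) simp
  have upd: "state S (x(Suc t := y)) t = state S x t" for x y
    by (rule state_cong) auto
  have "(\<integral>\<^sup>+\<rho>. F (state S \<rho> t) (\<rho> (Suc t)) \<partial>randomness) =
      (\<integral>\<^sup>+x. (\<integral>\<^sup>+y. F (state S x t) y \<partial>noise (Suc t)) \<partial>Pi\<^sub>M I noise)"
    using F1 unfolding I(1) by (subst noise.product_nn_integral_insert[OF I(2,3)]) (auto simp: upd)
  also have "\<dots> = (\<integral>\<^sup>+\<rho>. (\<integral>\<^sup>+y. F (state S \<rho> t) y \<partial>noise (Suc t)) \<partial>randomness)"
    using F2 unfolding I(1)
    by (subst noise.product_nn_integral_insert[OF I(2,3)]) (auto simp: upd noise_total)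
  finally show ?thesis .
qed

subsection \<open>Empirical equilibria\<close>

lemma operator_at:
  assumes "x \<in> space X"
  shows "monotone_operator_on Z (\<lambda>z. g z x)" "z \<in> Z \<Longrightarrow> norm (g z x) \<le> L" "\<beta>-lipschitz_on Z (\<lambda>z. g z x)"
  using operator assms by (auto simp: svi_operator_def)

lemma empirical_monotone:
  assumes "b \<in> space (dataset_space m X)"
  shows "monotone_operator_on Z (empirical_operator m g b)"
proof -
  have b: "b j \<in> space X" if "j < m" for j using assms that by (auto simp: space_PiM)
  have "0 \<le> inner (empirical_operator m g b u - empirical_operator m g b v) (u - v)" if "u \<in> Z" "v \<in> Z" for u v
  proof -
    have "inner (empirical_operator m g b u - empirical_operator m g b v) (u - v) =
       (1 / real m) * (\<Sum>j<m. inner (g u (b j) - g v (b j)) (u - v))"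
      by (simp add: empirical_operator_def inner_diff_left inner_sum_left sum_subtractf right_diff_distrib diff_divide_distrib)
    also have "\<dots> \<ge> 0"
      using operator_at(1)[OF b] that by (intro mult_nonneg_nonneg sum_nonneg) (auto simp: monotone_operator_on_def)
    finally show ?thesis .
  qed
  then show ?thesis by (simp add: monotone_operator_on_def)
qed

lemma empirical_continuous:
  assumes "b \<in> space (dataset_space m X)"
  shows "continuous_on Z (empirical_operator m g b)"
proof -
  have "continuous_on Z (\<lambda>u. g u (b j))" if "j < m" for j
    by (rule lipschitz_on_continuous_on[OF operator_at(3)]) (use assms that in \<open>auto simp: space_PiM\<close>)
  then show ?thesis unfolding empirical_operator_def by (intro continuous_intros) auto
qed

lemma regularized_equilibrium_exists:
  assumes "continuous_on Z G"
  shows "\<exists>z. equilibrium Z (\<lambda>u. G u + a *\<^sub>R (u - w)) z"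
  using assms z0_in by (intro equilibrium_exists compact_Z convex_Z continuous_intros) auto

lemma solve_accuracy:
  assumes t: "Suc t \<le> T" and b: "b \<in> space (dataset_space m X)"
    and z: "equilibrium Z (\<lambda>u. empirical_operator m g b u + coef t *\<^sub>R (u - w)) z"
  shows "(\<integral>\<^sup>+\<omega>. ennreal (norm (z - solve t b w \<omega>)) \<partial>W (Suc t)) \<le>
    ennreal (solver_accuracy L lam m \<delta> (Suc t))"
proof -
  let ?r = "\<lambda>u. coef t *\<^sub>R (u - w)" and ?K = "solver_K c L B lam m \<delta> (Suc t)"
  let ?\<alpha> = "solver_accuracy L lam m \<delta> (Suc t)"
  have "strongly_monotone_on (2 ^ Suc t * lam) Z ?r" by (rule strongly_monotone_regularizer)
  moreover have "continuous_on Z ?r" by (intro continuous_intros)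
  ultimately have "(\<integral>\<^sup>+\<omega>. ennreal (norm (z - solve t b w \<omega>)) \<partial>W (Suc t)) \<le> ennreal (c * B * exp (- ?K))"
    using solver[of "Suc t"] t b z unfolding accelerated_solver_def solve_def diameter_Z empirical_operator_def
    by simp
  also have "c * B * exp (- ?K) \<le> ?\<alpha>"
  proof -
    have \<alpha>: "?\<alpha> > 0" using delta_pos L_pos lam_pos m_pos by (simp add: solver_accuracy_def)
    \<comment> \<open>The maximum with 1 in \<open>solver_K\<close> can only improve the
      accuracy.\<close>
    have "exp (- ?K) \<le> exp (- ln (c * B / ?\<alpha>))" by (simp add: solver_K_def)
    also have "\<dots> = ?\<alpha> / (c * B)" using \<alpha> c_pos B_pos by (simp add: exp_minus)
    finally show ?thesis using c_pos B_pos by (simp add: field_simps)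
  qed
  finally show ?thesis by (simp add: ennreal_leI)
qed

section \<open>Privacy\<close>

lemma equilibrium_sensitivity:
  assumes b: "b \<in> space (dataset_space m X)" "b' \<in> space (dataset_space m X)" and nb: "neighbouring m b b'"
    and z: "equilibrium Z (\<lambda>u. empirical_operator m g b u + coef t *\<^sub>R (u - w)) z"
      "equilibrium Z (\<lambda>u. empirical_operator m g b' u + coef t *\<^sub>R (u - w)) z'"
  shows "norm (z - z') \<le> 2 * L / (2 ^ Suc t * lam * real m)"
proof -
  obtain i where i: "i < m" "\<And>j. j < m \<Longrightarrow> j \<noteq> i \<Longrightarrow> b j = b' j"
    using nb by (auto simp: neighbouring_def)
  have "(\<Sum>j<m. g z' (b' j)) - (\<Sum>j<m. g z' (b j)) = (\<Sum>j<m. if j = i then g z' (b' i) - g z' (b i) else 0)"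
    unfolding sum_subtractf[symmetric] using i(2) by (intro sum.cong) auto
  also have "\<dots> = g z' (b' i) - g z' (b i)" using i(1) by (simp add: sum.delta)
  finally have d: "empirical_operator m g b' z' - empirical_operator m g b z' = (1 / real m) *\<^sub>R (g z' (b' i) - g z' (b i))"
    unfolding empirical_operator_def scaleR_diff_right[symmetric] by simp
  have sp: "b i \<in> space X" "b' i \<in> space X" using b i(1) by (auto simp: space_PiM)
  have "z' \<in> Z" using z by (simp add: equilibrium_def)
  then have "norm (g z' (b' i) - g z' (b i)) \<le> 2 * L"
    using operator_at(2)[OF sp(1)] operator_at(2)[OF sp(2)] norm_triangle_ineq4[of "g z' (b' i)" "g z' (b i)"] by fastforce
  then have "norm (empirical_operator m g b' z' - empirical_operator m g b z') \<le> 2 * L / real m"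
    unfolding d by (simp add: divide_right_mono)
  moreover have "norm (z - z') \<le> norm ((empirical_operator m g b' z' + coef t *\<^sub>R (z' - w)) -
      (empirical_operator m g b z' + coef t *\<^sub>R (z' - w))) / (2 ^ Suc t * lam)"
    using lam_pos
    by (intro equilibrium_stability[OF z strongly_monotone_on_add[OF empirical_monotone[OF b(1)] coef_ge]]) simp
  ultimately have "norm (z - z') \<le> (2 * L / real m) / (2 ^ Suc t * lam)"
    using lam_pos by (smt (verit) add_diff_cancel_right divide_right_mono mult_pos_pos zero_less_power)
  then show ?thesis by (simp add: mult.commute)
qed

text \<open>The incoming state is the same on both sides, so both runs solve problems with the same
  regularizer and differ only in one summand of the empirical operator.\<close>

lemma step_privacy:
  assumes small: "\<epsilon> \<le> 2 * ln (2 / \<delta>)" and t: "Suc t \<le> T"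
    and b: "b \<in> space (dataset_space m X)" "b' \<in> space (dataset_space m X)" and nb: "neighbouring m b b'"
    and f: "f \<in> borel_measurable (borel \<Otimes>\<^sub>M borel)" "\<And>x. f x \<le> 1"
  shows "(\<integral>\<^sup>+y. f (step t b s y) \<partial>noise (Suc t)) \<le>
    ennreal (exp \<epsilon>) * (\<integral>\<^sup>+y. f (step t b' s y) \<partial>noise (Suc t)) + ennreal \<delta>"
proof -
  note [measurable] = f(1)
  interpret N: prob_space "gaussian_noise (sdev (Suc t)) :: 'a measure"
    by (rule prob_space_gaussian_noise[OF sdev_pos])
  define w where "w = snd s"
  \<comment> \<open>The new centre is a function of the new point and \<open>w\<close>, so releasing
    both is post-processing of the noisy point.\<close>
  define F where "F z = f (z, centre t w z)" for z
  have F[measurable]: "F \<in> borel_measurable borel" unfolding F_def by measurable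
  have sm[measurable]: "solve t b0 w \<in> borel_measurable (W (Suc t))" if "b0 \<in> space (dataset_space m X)" for b0
    using that by (intro measurable_solve'[OF t, where k = "\<lambda>x. x"]) auto
  have eq: "(\<integral>\<^sup>+y. f (step t b0 s y) \<partial>noise (Suc t)) =
      (\<integral>\<^sup>+\<omega>. (\<integral>\<^sup>+x. F (solve t b0 w \<omega> + x) \<partial>gaussian_noise (sdev (Suc t))) \<partial>W (Suc t))"
    if b0: "b0 \<in> space (dataset_space m X)" for b0
  proof -
    note [measurable] = sm[OF b0]
    have "(\<lambda>y. F (solve t b0 w (fst y) + snd y)) \<in> borel_measurable (W (Suc t) \<Otimes>\<^sub>M gaussian_noise (sdev (Suc t)))"
      by measurable
    from N.nn_integral_fst[OF this] show ?thesis
      unfolding noise_Suc[OF t] by (simp add: step_def F_def w_def)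
  qed
  define \<Delta> where "\<Delta> = 2 * L / (2 ^ Suc t * lam * real m)"
  have \<Delta>: "\<Delta> > 0" using L_pos lam_pos m_pos by (simp add: \<Delta>_def)
  \<comment> \<open>The constants 5 and 8 of the algorithm, rewritten in terms of the sensitivity,
    are the 10 and the 4 of \<open>noisy_output_privacy\<close>.\<close>
  have acc: "solver_accuracy L lam m \<delta> (Suc t) = \<delta> * \<Delta> / 10"
    by (simp add: solver_accuracy_def \<Delta>_def)
  have sc: "sdev (Suc t) = 4 * \<Delta> * sqrt (ln (2 / \<delta>)) / \<epsilon>"
    by (simp add: noise_scale_def \<Delta>_def mult_ac)
  obtain z z' where z: "equilibrium Z (\<lambda>u. empirical_operator m g b u + coef t *\<^sub>R (u - w)) z"
      "equilibrium Z (\<lambda>u. empirical_operator m g b' u + coef t *\<^sub>R (u - w)) z'"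
    using regularized_equilibrium_exists empirical_continuous b by metis
  show ?thesis
    unfolding eq[OF b(1)] eq[OF b(2)]
  proof (rule noisy_output_privacy[OF prob_space_W F])
    show "Suc t \<in> {1..T}" using t by simp
    show "norm (z - z') \<le> \<Delta>" unfolding \<Delta>_def by (rule equilibrium_sensitivity[OF b nb z])
  qed (use f(2) solve_accuracy[OF t b(1) z(1)] solve_accuracy[OF t b(2) z(2)] sm b eps_pos delta_pos delta_less
      small \<Delta> sc in \<open>auto simp: acc F_def\<close>)
qed

lemma neighbouring_batch:
  assumes nb: "neighbouring n S S'" and t: "t \<in> {1..T}"
  shows "neighbouring m (batch m idx t S) (batch m idx t S')"
    and "batch m idx t S \<noteq> batch m idx t S' \<Longrightarrow> k \<in> {1..T} \<Longrightarrow> k \<noteq> t \<Longrightarrow>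
      batch m idx k S = batch m idx k S'"
proof -
  obtain i where i: "i < n" "\<And>j. j < n \<Longrightarrow> j \<noteq> i \<Longrightarrow> S j = S' j"
    using nb by (auto simp: neighbouring_def)
  show "neighbouring m (batch m idx t S) (batch m idx t S')"
  proof (cases "\<exists>j<m. idx t j = i")
    case True
    then obtain j where j: "j < m" "idx t j = i" by auto
    then have "S (idx t k) = S' (idx t k)" if "k < m" "k \<noteq> j" for k
      using idx_inj[of t k t j] that t by (intro i(2) idx_less) auto
    then show ?thesis using j by (auto simp: neighbouring_def batch_def)
  next
    case False
    then have "S (idx t k) = S' (idx t k)" if "k < m" for k
      using that t by (intro i(2) idx_less) auto
    \<comment> \<open>Even for equal batches \<open>neighbouring\<close> asks for an index; a
      nonempty batch provides one.\<close>
    then show ?thesis using m_pos by (auto simp: neighbouring_def batch_def)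
  qed
  assume ne: "batch m idx t S \<noteq> batch m idx t S'" and k: "k \<in> {1..T}" "k \<noteq> t"
  have "\<exists>j<m. S (idx t j) \<noteq> S' (idx t j)"
  proof (rule ccontr)
    assume "\<not> ?thesis"
    then have "batch m idx t S = batch m idx t S'" by (auto simp: batch_def)
    with ne show False ..
  qed
  then obtain j where "j < m" "S (idx t j) \<noteq> S' (idx t j)" by auto
  with i(2)[OF idx_less[OF t]] have j: "j < m" "idx t j = i" by auto
  have "S (idx k l) = S' (idx k l)" if "l < m" for l
    using idx_inj[of k l t j] j that t k by (intro i(2) idx_less) auto
  then show "batch m idx k S = batch m idx k S'"
    by (auto simp: batch_def)
qed

text \<open>Integrating out the noise of the last round turns \<open>f\<close> into the test
  function \<open>h b\<close> of the previous state. If the last batches agree, the induction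
  hypothesis applies to it, which is why \<open>f\<close> is arbitrary. If they differ, all earlier
  batches agree, the previous states coincide, and the last round alone pays. Hence \<epsilon> and
  \<delta> are spent once and not once per round.\<close>

lemma state_privacy:
  assumes small: "\<epsilon> \<le> 2 * ln (2 / \<delta>)" and nb: "neighbouring n S S'"
    and S: "S \<in> space (dataset_space n X)" "S' \<in> space (dataset_space n X)"
    and "t \<le> T" "f \<in> borel_measurable (borel \<Otimes>\<^sub>M borel)" "\<And>x. f x \<le> 1"
  shows "(\<integral>\<^sup>+\<rho>. f (state S \<rho> t) \<partial>randomness) \<le>
    ennreal (exp \<epsilon>) * (\<integral>\<^sup>+\<rho>. f (state S' \<rho> t) \<partial>randomness) + ennreal \<delta>"
  using assms(5-7)
proof (induction t arbitrary: f)
  case 0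
  have "1 * f (z\<^sub>0, z\<^sub>0) \<le> ennreal (exp \<epsilon>) * f (z\<^sub>0, z\<^sub>0)"
    using eps_pos by (intro mult_right_mono) (auto simp: one_ennreal_def[symmetric] simp flip: ennreal_1 intro: ennreal_leI)
  then show ?case by (simp add: randomness.emeasure_space_1 add_increasing2 del: One_nat_def)
next
  case (Suc t)
  note [measurable] = Suc.prems(2)
  define b b' where "b = batch m idx (Suc t) S" and "b' = batch m idx (Suc t) S'"
  have bs: "b \<in> space (dataset_space m X)" "b' \<in> space (dataset_space m X)"
    using S Suc.prems(1) by (auto simp: b_def b'_def intro: batch_in_space)
  define h where "h b s = (\<integral>\<^sup>+y. f (step t b s y) \<partial>noise (Suc t))" for b s
  have meas: "(\<lambda>(s, y). f (step t b0 s y)) \<in> borel_measurable ((borel \<Otimes>\<^sub>M borel) \<Otimes>\<^sub>M noise (Suc t))"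
    if "b0 \<in> space (dataset_space m X)" for b0
  proof -
    have "(\<lambda>x. step t b0 (fst x) (snd x)) \<in> (borel \<Otimes>\<^sub>M borel) \<Otimes>\<^sub>M noise (Suc t) \<rightarrow>\<^sub>M borel \<Otimes>\<^sub>M borel"
      using that by (intro measurable_step Suc.prems(1)) auto
    from measurable_compose[OF this Suc.prems(2)] show ?thesis by (simp add: split_beta)
  qed
  have eq: "(\<integral>\<^sup>+\<rho>. f (state S0 \<rho> (Suc t)) \<partial>randomness) = (\<integral>\<^sup>+\<rho>. h (batch m idx (Suc t) S0) (state S0 \<rho> t) \<partial>randomness)"
    if S0: "S0 \<in> space (dataset_space n X)" for S0
    using nn_integral_resample_noise[OF Suc.prems(1) S0 meas[OF batch_in_space[OF S0]]] Suc.prems(1)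
    by (simp add: h_def)
  have h1: "h b s \<le> 1" for b s
  proof -
    have "h b s \<le> (\<integral>\<^sup>+y. 1 \<partial>noise (Suc t))" unfolding h_def by (intro nn_integral_mono Suc.prems)
    then show ?thesis by (simp add: noise_total)
  qed
  have hm: "h b0 \<in> borel_measurable (borel \<Otimes>\<^sub>M borel)" if "b0 \<in> space (dataset_space m X)" for b0
    using noise_borel_measurable_nn_integral[OF meas[OF that]] by (simp add: h_def[abs_def])
  show ?case
  proof (cases "b = b'")
    case True
    have "(\<integral>\<^sup>+\<rho>. h b (state S \<rho> t) \<partial>randomness) \<le>
        ennreal (exp \<epsilon>) * (\<integral>\<^sup>+\<rho>. h b (state S' \<rho> t) \<partial>randomness) + ennreal \<delta>"
      using Suc.prems(1) by (intro Suc.IH hm bs h1) auto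
    then show ?thesis using True eq[OF S(1)] eq[OF S(2)] by (simp add: b_def b'_def)
  next
    case False
    have st: "state S \<rho> t = state S' \<rho> t" for \<rho>
      using neighbouring_batch(2)[OF nb, of "Suc t"] False Suc.prems(1)
      by (intro state_cong) (auto simp: b_def b'_def)
    have sm: "(\<lambda>\<rho>. state S' \<rho> t) \<in> randomness \<rightarrow>\<^sub>M borel \<Otimes>\<^sub>M borel"
      using Suc.prems(1) by (intro measurable_state_fixed S) simp
    have hs[measurable]: "(\<lambda>\<rho>. h b' (state S' \<rho> t)) \<in> borel_measurable randomness"
      by (rule measurable_compose[OF sm hm[OF bs(2)]])
    have "(\<integral>\<^sup>+\<rho>. h b (state S' \<rho> t) \<partial>randomness) \<le>
        (\<integral>\<^sup>+\<rho>. ennreal (exp \<epsilon>) * h b' (state S' \<rho> t) + ennreal \<delta> \<partial>randomness)"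
      unfolding h_def using neighbouring_batch(1)[OF nb, of "Suc t"] Suc.prems bs
      by (intro nn_integral_mono step_privacy[OF small]) (auto simp: b_def b'_def)
    also have "\<dots> = ennreal (exp \<epsilon>) * (\<integral>\<^sup>+\<rho>. h b' (state S' \<rho> t) \<partial>randomness) + ennreal \<delta>"
      using hs by (simp add: nn_integral_add nn_integral_cmult randomness.emeasure_space_1 del: One_nat_def)
    finally show ?thesis using eq[OF S(1)] eq[OF S(2)] by (simp add: b_def b'_def st)
  qed
qed

lemma R_SVI_privacy:
  assumes "\<epsilon> \<le> 2 * ln (2 / \<delta>)"
  shows "differentially_private \<epsilon> \<delta> X n
    (\<lambda>S. distr randomness borel (\<lambda>\<rho>. run g (R_SVI lam T m idx P z\<^sub>0 S \<rho>)))"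
  unfolding differentially_private_def run_R_SVI
proof (intro ballI impI)
  fix S S' E
  assume S: "S \<in> space (dataset_space n X)" "S' \<in> space (dataset_space n X)" and nb: "neighbouring n S S'"
    and "E \<in> sets (distr randomness borel (\<lambda>\<rho>. fst (state S \<rho> T)))"
  then have E[measurable]: "E \<in> sets borel" by simp
  let ?Q = "\<lambda>S. distr randomness borel (\<lambda>\<rho>. fst (state S \<rho> T))"
  have sm[measurable]: "(\<lambda>\<rho>. state S0 \<rho> T) \<in> randomness \<rightarrow>\<^sub>M borel \<Otimes>\<^sub>M borel" if "S0 \<in> space (dataset_space n X)" for S0
    using that by (intro measurable_state_fixed) simp
  have Q: "prob_space (?Q S0)" if "S0 \<in> space (dataset_space n X)" for S0
    using sm[OF that] by (intro randomness.prob_space_distr) simp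
  have em: "emeasure (?Q S0) E = (\<integral>\<^sup>+\<rho>. indicator E (fst (state S0 \<rho> T)) \<partial>randomness)"
    if "S0 \<in> space (dataset_space n X)" for S0
  proof -
    note [measurable] = sm[OF that]
    have "emeasure (?Q S0) E = (\<integral>\<^sup>+x. indicator E x \<partial>?Q S0)" by simp
    also have "\<dots> = (\<integral>\<^sup>+\<rho>. indicator E (fst (state S0 \<rho> T)) \<partial>randomness)"
      by (rule nn_integral_distr) measurable
    finally show ?thesis .
  qed
  have "emeasure (?Q S) E \<le> ennreal (exp \<epsilon>) * emeasure (?Q S') E + ennreal \<delta>"
    unfolding em[OF S(1)] em[OF S(2)]
    by (rule state_privacy[OF assms nb S, where f = "\<lambda>s. indicator E (fst s)"]) (auto simp: indicator_def)
  then have "ennreal (measure (?Q S) E) \<le> ennreal (exp \<epsilon> * measure (?Q S') E + \<delta>)"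
    using Q[OF S(1)] Q[OF S(2)] delta_pos
    by (simp add: finite_measure.emeasure_eq_measure prob_space.finite_measure ennreal_mult ennreal_plus)
  then show "measure (?Q S) E \<le> exp \<epsilon> * measure (?Q S') E + \<delta>"
    using delta_pos by (subst (asm) ennreal_le_iff) (auto intro!: add_nonneg_nonneg)
qed

end

section \<open>Gradient evaluations\<close>

text \<open>Only the solver calls consult the oracle. Their bound holds for every seed, so the count
  is bounded on every execution and not only on average.\<close>

lemma (in recursive_regularization) evals_R_SVI_state:
  assumes "t \<le> T" "S \<in> space (dataset_space n X)" "\<rho> \<in> space randomness"
  shows "real (evals g (R_SVI_state lam m idx P z\<^sub>0 S \<rho> t)) \<le>
    (\<Sum>k = 1..t. c\<^sub>0 * (real m + sqrt (real m) * solver_K c L B lam m \<delta> k * \<beta> / (2 ^ k * lam)))"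
  using assms(1)
proof (induction t)
  case 0
  then show ?case by simp
next
  case (Suc t)
  let ?r = "\<lambda>u. coef t *\<^sub>R (u - snd (state S \<rho> t))"
  have "strongly_monotone_on (2 ^ Suc t * lam) Z ?r" by (rule strongly_monotone_regularizer)
  moreover have "continuous_on Z ?r" by (intro continuous_intros)
  moreover have "batch m idx (Suc t) S \<in> space (dataset_space m X)"
    using Suc.prems by (intro batch_in_space assms(2)) auto
  moreover have "fst (\<rho> (Suc t)) \<in> space (W (Suc t))"
  proof -
    have "\<rho> (Suc t) \<in> space (noise (Suc t))" using assms(3) Suc.prems by (auto simp: space_PiM)
    then show ?thesis using Suc.prems by (auto simp: noise_Suc space_pair_measure)
  qed
  ultimately have "real (evals g (P (Suc t) (fst (\<rho> (Suc t))) (batch m idx (Suc t) S) ?r)) \<le>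
      c\<^sub>0 * (real m + sqrt (real m) * solver_K c L B lam m \<delta> (Suc t) * \<beta> / (2 ^ Suc t * lam))"
    using solver[of "Suc t"] Suc.prems unfolding accelerated_solver_def by auto
  then show ?case
    using Suc by (simp add: evals_and_then run_R_SVI_state A_emp_def split_beta)
qed

lemma (in recursive_regularization) evals_R_SVI:
  assumes "S \<in> space (dataset_space n X)" "\<rho> \<in> space randomness"
  shows "real (evals g (R_SVI lam T m idx P z\<^sub>0 S \<rho>)) \<le>
    (\<Sum>k = 1..T. c\<^sub>0 * (real m + sqrt (real m) * solver_K c L B lam m \<delta> k * \<beta> / (2 ^ k * lam)))"
  using evals_R_SVI_state[OF order_refl assms] by (simp add: R_SVI_def evals_and_then split_beta)

section \<open>Population quantities\<close>

locale recursive_regularization_population = recursive_regularization X Z g n m T L \<beta> B \<epsilon> \<delta> lam c c\<^sub>0 idx W P z\<^sub>0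
  for X :: "'x measure"
    and Z :: "'a::euclidean_space set"
    and g :: "'a \<Rightarrow> 'x \<Rightarrow> 'a"
    and n m T :: nat
    and L \<beta> B \<epsilon> \<delta> lam c c\<^sub>0 :: real
    and idx :: "nat \<Rightarrow> nat \<Rightarrow> nat"
    and W :: "nat \<Rightarrow> 'w measure"
    and P :: "nat \<Rightarrow> 'w \<Rightarrow> (nat \<Rightarrow> 'x) \<Rightarrow> ('a \<Rightarrow> 'a) \<Rightarrow> ('a, 'x, 'a) grad_prog"
    and z\<^sub>0 :: 'a +
  fixes D :: "'x measure"
  assumes prob_space_D: "prob_space D" and sets_D: "sets D = sets X"
begin

sublocale D: prob_space D by (rule prob_space_D)

sublocale data: prob_space "dataset_space n D" by (intro prob_space_PiM prob_space_D)

lemma space_D: "space D = space X"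
  using sets_D by (rule sets_eq_imp_space_eq)

lemma sets_dataset_space: "sets (dataset_space k D) = sets (dataset_space k X)"
  by (intro sets_PiM_cong refl sets_D)

lemma space_dataset_space: "space (dataset_space k D) = space (dataset_space k X)"
  by (rule sets_eq_imp_space_eq[OF sets_dataset_space])

lemma measurable_dataset_space: "measurable M (dataset_space k D) = measurable M (dataset_space k X)"
  by (rule measurable_cong_sets[OF refl sets_dataset_space])

section \<open>The population operator and its regularized equilibria\<close>

abbreviation "G \<equiv> population_operator D g"

lemma measurable_g: "z \<in> Z \<Longrightarrow> g z \<in> borel_measurable D"
  using operator measurable_cong_sets[OF sets_D refl] by (auto simp: svi_operator_def)

lemma integrable_g: "z \<in> Z \<Longrightarrow> integrable D (g z)"
  by (rule D.integrable_const_bound[where B = L]) (auto intro!: AE_I2 operator_at(2) measurable_g simp: space_D)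

lemma inner_G: "z \<in> Z \<Longrightarrow> inner (G z) w = (\<integral>x. inner (g z x) w \<partial>D)"
  using integrable_g by (simp add: population_operator_def)

lemma norm_G_le:
  assumes "z \<in> Z"
  shows "norm (G z) \<le> L"
proof -
  have "norm (G z) \<le> (\<integral>x. norm (g z x) \<partial>D)" unfolding population_operator_def by (rule integral_norm_bound)
  also have "\<dots> \<le> (\<integral>x. L \<partial>D)"
    using integrable_g[OF assms] operator_at(2) assms by (intro integral_mono) (auto simp: space_D)
  finally show ?thesis by (simp add: D.prob_space)
qed

lemma G_monotone: "monotone_operator_on Z G"
proof -
  have "0 \<le> inner (G u - G v) (u - v)" if "u \<in> Z" "v \<in> Z" for u v
  proof -
    have "inner (G u - G v) (u - v) = (\<integral>x. inner (g u x - g v x) (u - v) \<partial>D)"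
      using that integrable_g by (simp add: inner_diff_left inner_G)
    also have "\<dots> \<ge> 0"
      using operator_at(1) that by (intro integral_nonneg_AE AE_I2) (auto simp: monotone_operator_on_def space_D)
    finally show ?thesis .
  qed
  then show ?thesis by (simp add: monotone_operator_on_def)
qed

lemma G_continuous: "continuous_on Z G"
proof -
  \<comment> \<open>The sign of \<beta> is contained in \<open>lipschitz_on\<close>, which is
    available at a data point only; a probability space has one.\<close>
  obtain x where "x \<in> space X" using D.not_empty space_D by auto
  then have \<beta>: "\<beta> \<ge> 0" using operator_at(3) by (auto simp: lipschitz_on_def)
  have "\<beta>-lipschitz_on Z G"
  proof (rule lipschitz_onI[OF _ \<beta>])
    fix u v assume uv: "u \<in> Z" "v \<in> Z"
    have "dist (G u) (G v) = norm (\<integral>x. g u x - g v x \<partial>D)"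
      using uv integrable_g by (simp add: dist_norm population_operator_def)
    also have "\<dots> \<le> (\<integral>x. norm (g u x - g v x) \<partial>D)" by (rule integral_norm_bound)
    also have "\<dots> \<le> (\<integral>x. \<beta> * dist u v \<partial>D)"
      using uv integrable_g operator_at(3)
      by (intro integral_mono) (auto simp: space_D lipschitz_on_def dist_norm)
    finally show "dist (G u) (G v) \<le> \<beta> * dist u v" by (simp add: D.prob_space)
  qed
  then show ?thesis by (rule lipschitz_on_continuous_on)
qed

text \<open>Strong monotonicity makes this equilibrium unique, so the choice operator selects a
  definite function of the centre, the resolvent of the population operator.\<close>

definition regularized_solution :: "nat \<Rightarrow> 'a \<Rightarrow> 'a" where
  "regularized_solution t w = (SOME z. equilibrium Z (\<lambda>u. G u + coef t *\<^sub>R (u - w)) z)"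

lemma regularized_solution:
  "equilibrium Z (\<lambda>u. G u + coef t *\<^sub>R (u - w)) (regularized_solution t w)"
  unfolding regularized_solution_def
  by (rule someI_ex) (rule regularized_equilibrium_exists[OF G_continuous])

lemma regularized_solution_in: "regularized_solution t w \<in> Z"
  using regularized_solution by (simp add: equilibrium_def)

text \<open>Resolvents are nonexpansive: moving the centre perturbs the operator by
  \<open>coef t\<close> times the displacement, and stability divides by the same factor.
  Measurability in the random centre follows.\<close>

lemma regularized_solution_lipschitz:
  "norm (regularized_solution t w - regularized_solution t w') \<le> norm (w - w')"
proof -
  let ?z' = "regularized_solution t w'"
  have "norm (regularized_solution t w - ?z') \<le>
      norm ((G ?z' + coef t *\<^sub>R (?z' - w')) - (G ?z' + coef t *\<^sub>R (?z' - w))) / coef t"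
    by (intro equilibrium_stability[OF regularized_solution regularized_solution
          strongly_monotone_on_add[OF G_monotone order_refl]] coef_pos)
  also have "(G ?z' + coef t *\<^sub>R (?z' - w')) - (G ?z' + coef t *\<^sub>R (?z' - w)) = coef t *\<^sub>R (w - w')"
    by (simp add: algebra_simps)
  finally show ?thesis using coef_pos[of t] by simp
qed

lemma borel_measurable_regularized_solution: "regularized_solution t \<in> borel_measurable borel"
proof (rule borel_measurable_continuous_onI)
  have "1-lipschitz_on UNIV (regularized_solution t)"
    using regularized_solution_lipschitz by (intro lipschitz_onI) (auto simp: dist_norm)
  then show "continuous_on UNIV (regularized_solution t)" by (rule lipschitz_on_continuous_on)
qed

lemma dist_Z_le: "u \<in> Z \<Longrightarrow> v \<in> Z \<Longrightarrow> norm (u - v) \<le> B"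
  using diameter_bounded_bound[OF compact_imp_bounded[OF compact_Z], of u v] diameter_Z by (simp add: dist_norm)

subsection \<open>The gap in terms of the errors of the rounds\<close>

text \<open>The distance is to the equilibrium of the regularized population operator around the centre that
  is current at the start of the round, not to the equilibrium of the unregularized problem.\<close>

definition err :: "(nat \<Rightarrow> 'x) \<Rightarrow> (nat \<Rightarrow> 'w \<times> 'a) \<Rightarrow> nat \<Rightarrow> real" where
  "err S \<rho> t = norm (fst (state S \<rho> (Suc t)) - regularized_solution t (snd (state S \<rho> t)))"

text \<open>Initially the weight is \<open>2 * lam\<close> and both points lie in \<open>Z\<close>.
  Each further round adds two displacements bounded by the error, each with a weight of at most
  \<open>2 ^ (t + 2) * lam\<close>, whence the exponent \<open>k + 3\<close>.\<close>

lemma norm_regularizer_le: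
  "norm (coef t *\<^sub>R (regularized_solution t (snd (state S \<rho> t)) - snd (state S \<rho> t))) \<le>
    2 * lam * B + (\<Sum>k<t. 2 ^ (k + 3) * lam * err S \<rho> k)"
proof (induction t)
  case 0
  then show ?case
    using dist_Z_le[OF regularized_solution_in[of 0 z\<^sub>0] z0_in] lam_pos by (simp add: coef_def)
next
  case (Suc t)
  define w z where "w = snd (state S \<rho> t)" and "z = fst (state S \<rho> (Suc t))"
  define u u' where "u = regularized_solution t w"
    and "u' = regularized_solution (Suc t) (snd (state S \<rho> (Suc t)))"
  define a where "a = 2 ^ (t + 2) * lam"
  have a: "a > 0" "coef t \<le> a" using lam_pos by (auto simp: a_def coef_def)
  have reg: "coef (Suc t) *\<^sub>R (v - snd (state S \<rho> (Suc t))) = coef t *\<^sub>R (v - w) + a *\<^sub>R (v - z)" for v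
    by (simp add: step_def coef_centre w_def z_def a_def)
  have e: "err S \<rho> t = norm (z - u)" by (simp add: err_def z_def u_def w_def)
  have mono: "monotone_operator_on Z (\<lambda>v. G v + coef t *\<^sub>R (v - w))"
    using strongly_monotone_on_add[OF G_monotone less_imp_le[OF coef_pos], of t w]
    by (simp add: strongly_monotone_on_def monotone_operator_on_def)
  have u': "equilibrium Z (\<lambda>v. (G v + coef t *\<^sub>R (v - w)) + a *\<^sub>R (v - z)) u'"
    using regularized_solution[of "Suc t" "snd (state S \<rho> (Suc t))"] unfolding u'_def reg by (simp add: add.assoc)
  have u: "equilibrium Z (\<lambda>v. G v + coef t *\<^sub>R (v - w)) u"
    unfolding u_def by (rule regularized_solution)
  have p: "norm (u' - u) \<le> norm (z - u)" "norm (u' - z) \<le> norm (z - u)"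
    using equilibrium_proximal_step[OF u u' mono a(1)] by auto
  \<comment> \<open>The old regularizer, evaluated at the new equilibrium, is its value at the old
    one plus a drift; the new regularizer is centred at the noisy point.\<close>
  have "coef (Suc t) *\<^sub>R (u' - snd (state S \<rho> (Suc t))) = coef t *\<^sub>R (u - w) + coef t *\<^sub>R (u' - u) + a *\<^sub>R (u' - z)"
    by (simp only: reg) (simp add: algebra_simps)
  also have "norm \<dots> \<le> norm (coef t *\<^sub>R (u - w)) + norm (coef t *\<^sub>R (u' - u)) + norm (a *\<^sub>R (u' - z))"
    by (intro norm_triangle_le add_mono order_refl norm_triangle_ineq)
  also have "norm (coef t *\<^sub>R (u' - u)) \<le> a * norm (z - u)"
    using p(1) a coef_pos[of t] by (simp add: mult_mono)
  also have "norm (a *\<^sub>R (u' - z)) \<le> a * norm (z - u)"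
    using p(2) a by simp
  also have "norm (coef t *\<^sub>R (u - w)) \<le> 2 * lam * B + (\<Sum>k<t. 2 ^ (k + 3) * lam * err S \<rho> k)"
    using Suc by (simp add: u_def w_def)
  finally show ?case by (simp add: u'_def e a_def algebra_simps power_add)
qed

text \<open>A real supremum is only meaningful for a bounded family. Here \<open>w\<close> ranges
  over the whole space, since the output need not lie in \<open>Z\<close>.\<close>

lemma inner_G_bdd: "bdd_above ((\<lambda>z. inner (G z) (w - z)) ` Z)"
proof -
  obtain r where r: "\<And>z. z \<in> Z \<Longrightarrow> norm z \<le> r"
    using compact_imp_bounded[OF compact_Z] by (auto simp: bounded_iff)
  have "inner (G z) (w - z) \<le> L * (norm w + r)" if "z \<in> Z" for z
  proof -
    have "inner (G z) (w - z) \<le> norm (G z) * norm (w - z)" by (rule norm_cauchy_schwarz)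
    also have "\<dots> \<le> L * (norm w + r)"
      using norm_G_le[OF that] r[OF that] norm_triangle_ineq4[of w z] L_pos by (intro mult_mono) auto
    finally show ?thesis .
  qed
  then show ?thesis by (intro bdd_aboveI2) auto
qed

lemma vi_loss_le_iff: "vi_loss D Z g w \<le> r \<longleftrightarrow> (\<forall>z\<in>Z. inner (G z) (w - z) \<le> r)"
  unfolding vi_loss_def using inner_G_bdd z0_in by (subst cSUP_le_iff) auto

lemma inner_G_le: "z \<in> Z \<Longrightarrow> inner (G z) v \<le> L * norm v"
  using norm_cauchy_schwarz[of "G z" v] mult_right_mono[OF norm_G_le norm_ge_zero, of z v] by linarith

text \<open>The loss is a supremum of affine functions with slopes \<open>G z\<close> of norm at
  most \<open>L\<close>. This transfers bounds from an equilibrium in \<open>Z\<close> to the noisy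
  output and also yields measurability.\<close>

lemma vi_loss_lipschitz: "\<bar>vi_loss D Z g w - vi_loss D Z g w'\<bar> \<le> L * norm (w - w')"
proof -
  have *: "vi_loss D Z g w \<le> vi_loss D Z g w' + L * norm (w - w')" for w w'
    unfolding vi_loss_le_iff
  proof
    fix z assume z: "z \<in> Z"
    have "inner (G z) (w - z) = inner (G z) (w' - z) + inner (G z) (w - w')"
      by (simp add: algebra_simps)
    also have "\<dots> \<le> vi_loss D Z g w' + L * norm (w - w')"
      using vi_loss_le_iff[of w' "vi_loss D Z g w'"] inner_G_le[OF z] z by (intro add_mono) auto
    finally show "inner (G z) (w - z) \<le> vi_loss D Z g w' + L * norm (w - w')" .
  qed
  from *[of w w'] *[of w' w] show ?thesis by (simp add: norm_minus_commute abs_le_iff)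
qed

lemma borel_measurable_vi_loss: "vi_loss D Z g \<in> borel_measurable borel"
proof (rule borel_measurable_continuous_onI)
  have "L-lipschitz_on UNIV (vi_loss D Z g)"
    using vi_loss_lipschitz L_pos by (intro lipschitz_onI) (auto simp: dist_norm)
  then show "continuous_on UNIV (vi_loss D Z g)" by (rule lipschitz_on_continuous_on)
qed

lemma vi_loss_in_Z:
  assumes "u \<in> Z"
  shows "\<bar>vi_loss D Z g u\<bar> \<le> L * B"
proof -
  have "vi_loss D Z g u \<le> L * B"
    unfolding vi_loss_le_iff
    using inner_G_le dist_Z_le[OF assms] L_pos by (meson mult_left_mono less_imp_le order_trans)
  moreover have "0 \<le> vi_loss D Z g u"
    using vi_loss_le_iff[of u "vi_loss D Z g u"] assms by fastforce
  ultimately show ?thesis by simp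
qed

text \<open>Monotonicity replaces \<open>G z\<close> by \<open>G u\<close> at the regularized
  equilibrium \<open>u\<close>, where the variational inequality leaves only the regularizer. The
  bound holds for every \<open>z\<close> and every realization, so the maximum inside the
  expectation in the strong gap causes no loss.\<close>

lemma vi_loss_state_le:
  "vi_loss D Z g (fst (state S \<rho> (Suc t))) \<le>
    L * err S \<rho> t + B * (2 * lam * B + (\<Sum>k<t. 2 ^ (k + 3) * lam * err S \<rho> k))"
  unfolding vi_loss_le_iff
proof
  fix z assume z: "z \<in> Z"
  define w where "w = snd (state S \<rho> t)"
  define u where "u = regularized_solution t w"
  define r where "r = coef t *\<^sub>R (u - w)"
  have u: "u \<in> Z" unfolding u_def by (rule regularized_solution_in)
  have "inner (G u + r) (u - z) \<le> 0"
    using regularized_solution[of t w] z by (simp add: equilibrium_def u_def r_def)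
  moreover have "0 \<le> inner (G u - G z) (u - z)"
    using G_monotone u z by (simp add: monotone_operator_on_def)
  moreover have "- inner r (u - z) \<le> norm r * norm (u - z)"
    using Cauchy_Schwarz_ineq2[of r "u - z"] by linarith
  moreover have "norm r * norm (u - z) \<le> (2 * lam * B + (\<Sum>k<t. 2 ^ (k + 3) * lam * err S \<rho> k)) * B"
    using norm_regularizer_le[of t S \<rho>] dist_Z_le[OF u z]
    by (intro mult_mono') (auto simp: r_def u_def w_def)
  moreover have "inner (G z) (fst (state S \<rho> (Suc t)) - u) \<le> L * err S \<rho> t"
    using inner_G_le[OF z] by (simp only: err_def u_def w_def)
  ultimately show "inner (G z) (fst (state S \<rho> (Suc t)) - z) \<le>
      L * err S \<rho> t + B * (2 * lam * B + (\<Sum>k<t. 2 ^ (k + 3) * lam * err S \<rho> k))"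
    by (simp add: inner_diff_left inner_diff_right inner_add_left mult.commute[of B])
qed

subsection \<open>Expected errors\<close>

text \<open>Solver inaccuracy, mean length of the noise, and the deviation \<open>L / sqrt m\<close>
  of a sample mean divided by the strong monotonicity parameter.\<close>

definition err_bound :: "nat \<Rightarrow> real" where
  "err_bound t = solver_accuracy L lam m \<delta> (Suc t) + sqrt (real DIM('a)) * sdev (Suc t) +
     L / (sqrt (real m) * (2 ^ Suc t * lam))"

text \<open>The arguments separate the past, the current batch and the fresh noise, so that they can
  be integrated one at a time.\<close>

definition step_err :: "nat \<Rightarrow> 'a \<Rightarrow> (nat \<Rightarrow> 'x) \<Rightarrow> 'w \<times> 'a \<Rightarrow> ennreal" where
  "step_err t w b y = ennreal (norm (solve t b w (fst y) + snd y - regularized_solution t w))"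

lemma err_eq_step_err:
  "ennreal (err S \<rho> t) = step_err t (snd (state S \<rho> t)) (batch m idx (Suc t) S) (\<rho> (Suc t))"
  by (simp add: err_def step_err_def step_def)

lemma measurable_step_err:
  assumes t: "Suc t \<le> T" and [measurable]: "f \<in> M \<rightarrow>\<^sub>M borel"
    and h: "h \<in> M \<rightarrow>\<^sub>M dataset_space m X" and k: "k \<in> M \<rightarrow>\<^sub>M noise (Suc t)"
  shows "(\<lambda>x. step_err t (f x) (h x) (k x)) \<in> borel_measurable M"
proof -
  have k'[measurable]: "k \<in> M \<rightarrow>\<^sub>M W (Suc t) \<Otimes>\<^sub>M (borel :: 'a measure)"
    using k unfolding noise_Suc[OF t]
    by (subst measurable_cong_sets[OF refl sets_pair_measure_cong[OF refl sets_gaussian_noise[symmetric]]])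
  have [measurable]: "(\<lambda>x. solve t (h x) (f x) (fst (k x))) \<in> borel_measurable M"
    by (rule measurable_solve'[OF t h]) measurable
  have [measurable]: "(\<lambda>x. regularized_solution t (f x)) \<in> borel_measurable M"
    by (rule measurable_compose[OF _ borel_measurable_regularized_solution]) measurable
  show ?thesis unfolding step_err_def by measurable
qed

text \<open>The triangle inequality goes through the empirical equilibrium \<open>z\<close>, which
  is picked for one fixed batch and no longer occurs in the bound. The deviation on the right is
  taken at \<open>u\<close>, which is determined by the centre alone.\<close>

lemma step_err_le:
  fixes w :: 'a
  assumes t: "Suc t \<le> T" and b: "b \<in> space (dataset_space m X)"
  defines "u \<equiv> regularized_solution t w"
  shows "(\<integral>\<^sup>+y. step_err t w b y \<partial>noise (Suc t)) \<le>
    ennreal (solver_accuracy L lam m \<delta> (Suc t) + sqrt (real DIM('a)) * sdev (Suc t)) +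
    ennreal (1 / (2 ^ Suc t * lam)) * ennreal (norm (G u - empirical_operator m g b u))"
proof -
  interpret W: prob_space "W (Suc t)" using t by (intro prob_space_W) simp
  interpret N: prob_space "gaussian_noise (sdev (Suc t)) :: 'a measure"
    by (rule prob_space_gaussian_noise[OF sdev_pos])
  let ?N = "gaussian_noise (sdev (Suc t)) :: 'a measure"
  obtain z where z: "equilibrium Z (\<lambda>u. empirical_operator m g b u + coef t *\<^sub>R (u - w)) z"
    using regularized_equilibrium_exists empirical_continuous[OF b] by metis
  define d where "d = norm (z - u)"
  have d: "d \<le> 1 / (2 ^ Suc t * lam) * norm (G u - empirical_operator m g b u)"
  proof -
    have "d \<le> norm ((G u + coef t *\<^sub>R (u - w)) - (empirical_operator m g b u + coef t *\<^sub>R (u - w))) / (2 ^ Suc t * lam)"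
      unfolding d_def u_def using lam_pos
      by (intro equilibrium_stability[OF z regularized_solution strongly_monotone_on_add[OF empirical_monotone[OF b] coef_ge]]) simp
    then show ?thesis by simp
  qed
  have sm[measurable]: "solve t b w \<in> borel_measurable (W (Suc t))"
    using b by (intro measurable_solve'[OF t, where k = "\<lambda>x. x"]) auto
  have le: "step_err t w b y \<le> (ennreal (norm (z - solve t b w (fst y))) + ennreal (norm (snd y))) + ennreal d" for y
  proof -
    have eq: "solve t b w (fst y) + snd y - u = (z - u) - (z - solve t b w (fst y)) + snd y" by simp
    have "norm (solve t b w (fst y) + snd y - u) \<le> norm (z - solve t b w (fst y)) + norm (snd y) + d"
      unfolding eq d_def
      using norm_triangle_ineq[of "(z - u) - (z - solve t b w (fst y))" "snd y"]
        norm_triangle_ineq4[of "z - u" "z - solve t b w (fst y)"] by linarith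
    then show ?thesis by (simp add: step_err_def u_def d_def flip: ennreal_plus)
  qed
  have "(\<integral>\<^sup>+y. step_err t w b y \<partial>noise (Suc t)) \<le>
      (\<integral>\<^sup>+y. (ennreal (norm (z - solve t b w (fst y))) + ennreal (norm (snd y))) + ennreal d \<partial>(W (Suc t) \<Otimes>\<^sub>M ?N))"
    unfolding noise_Suc[OF t] by (intro nn_integral_mono le)
  also have "\<dots> = (\<integral>\<^sup>+\<omega>. (\<integral>\<^sup>+x. (ennreal (norm (z - solve t b w \<omega>)) + ennreal (norm x)) + ennreal d \<partial>?N) \<partial>W (Suc t))"
    by (subst N.nn_integral_fst[symmetric]) simp_all
  also have "\<dots> = (\<integral>\<^sup>+\<omega>. ennreal (norm (z - solve t b w \<omega>)) \<partial>W (Suc t)) + (\<integral>\<^sup>+x. ennreal (norm x) \<partial>?N) + ennreal d"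
    by (simp add: nn_integral_add N.emeasure_space_1[simplified] W.emeasure_space_1)
  also have "\<dots> \<le> ennreal (solver_accuracy L lam m \<delta> (Suc t)) + ennreal (sqrt (real DIM('a)) * sdev (Suc t)) +
      ennreal (1 / (2 ^ Suc t * lam) * norm (G u - empirical_operator m g b u))"
    by (intro add_mono solve_accuracy[OF t b z] nn_integral_gaussian_noise_norm sdev_pos ennreal_leI d)
  also have "\<dots> = ennreal (solver_accuracy L lam m \<delta> (Suc t) + sqrt (real DIM('a)) * sdev (Suc t)) +
      ennreal (1 / (2 ^ Suc t * lam)) * ennreal (norm (G u - empirical_operator m g b u))"
  proof -
    have "ennreal (1 / (2 ^ Suc t * lam) * norm (G u - empirical_operator m g b u)) =
        ennreal (1 / (2 ^ Suc t * lam)) * ennreal (norm (G u - empirical_operator m g b u))"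
      using lam_pos by (intro ennreal_mult) auto
    then show ?thesis
      using delta_pos L_pos lam_pos less_imp_le[OF sdev_pos]
      by (subst ennreal_plus) (auto simp: solver_accuracy_def)
  qed
  finally show ?thesis .
qed

lemma mean_step_err_le:
  assumes t: "Suc t \<le> T"
  shows "(\<integral>\<^sup>+b. (\<integral>\<^sup>+y. step_err t w b y \<partial>noise (Suc t)) \<partial>dataset_space m D) \<le> ennreal (err_bound t)"
proof -
  interpret M: prob_space "dataset_space m D" by (intro prob_space_PiM prob_space_D)
  let ?u = "regularized_solution t w" and ?q = "2 ^ Suc t * lam"
  let ?s = "solver_accuracy L lam m \<delta> (Suc t) + sqrt (real DIM('a)) * sdev (Suc t)"
  have u: "?u \<in> Z" by (rule regularized_solution_in)
  have s: "?s \<ge> 0" using delta_pos L_pos lam_pos less_imp_le[OF sdev_pos] by (auto simp: solver_accuracy_def)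
  have gm: "(\<lambda>b. g ?u (b j)) \<in> borel_measurable (dataset_space m D)" if "j < m" for j
    using that by (intro measurable_compose[OF _ measurable_g[OF u]] measurable_component_singleton) auto
  have meas: "(\<lambda>b. ennreal (norm (G ?u - empirical_operator m g b ?u))) \<in> borel_measurable (dataset_space m D)"
    unfolding empirical_operator_def using gm by measurable
  have dev: "(\<integral>\<^sup>+b. ennreal (norm (G ?u - empirical_operator m g b ?u)) \<partial>dataset_space m D) \<le> ennreal (L / sqrt (real m))"
    unfolding empirical_operator_def population_operator_def
    using u operator_at(2) L_pos m_pos
    by (intro nn_integral_sample_mean_deviation prob_space_D measurable_g) (auto simp: space_D)
  have "(\<integral>\<^sup>+b. (\<integral>\<^sup>+y. step_err t w b y \<partial>noise (Suc t)) \<partial>dataset_space m D) \<le>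
      (\<integral>\<^sup>+b. ennreal ?s + ennreal (1 / ?q) * ennreal (norm (G ?u - empirical_operator m g b ?u)) \<partial>dataset_space m D)"
    by (intro nn_integral_mono step_err_le[OF t]) (simp add: space_dataset_space)
  also have "\<dots> = ennreal ?s + ennreal (1 / ?q) * (\<integral>\<^sup>+b. ennreal (norm (G ?u - empirical_operator m g b ?u)) \<partial>dataset_space m D)"
    using meas by (subst nn_integral_add) (auto simp: nn_integral_cmult M.emeasure_space_1)
  also have "\<dots> \<le> ennreal ?s + ennreal (1 / ?q) * ennreal (L / sqrt (real m))"
    by (intro add_left_mono mult_left_mono dev) simp
  also have "\<dots> = ennreal (err_bound t)"
    using s L_pos lam_pos by (subst ennreal_mult[symmetric]) (auto simp: err_bound_def mult.commute simp flip: ennreal_plus)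
  finally show ?thesis .
qed

text \<open>For fixed noise the state before the round does not depend on the batch used in it, so
  concentration is only needed at a single point of \<open>Z\<close> and not uniformly.\<close>

lemma expected_err_fixed_noise:
  assumes t: "Suc t \<le> T" and \<rho>: "\<rho> \<in> space randomness"
  shows "(\<integral>\<^sup>+S. (\<integral>\<^sup>+y. step_err t (snd (state S \<rho> t)) (batch m idx (Suc t) S) y \<partial>noise (Suc t))
    \<partial>dataset_space n D) \<le> ennreal (err_bound t)"
proof -
  interpret PD: product_prob_space "\<lambda>_::nat. D" ..
  \<comment> \<open>The dataset splits into the points of the current batch and all others; earlier
    batches, and hence the state, use the latter only.\<close>
  define J where "J = idx (Suc t) ` {..<m}"
  define I where "I = {..<n} - J"
  have J: "J \<subseteq> {..<n}" using idx_less t by (auto simp: J_def)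
  have IJ: "I \<inter> J = {}" "finite I" "finite J" "I \<union> J = {..<n}" using J by (auto simp: I_def J_def)
  define reindex where "reindex y = (\<lambda>j\<in>{..<m}. y (idx (Suc t) j))" for y :: "nat \<Rightarrow> 'x"
  have b1: "batch m idx (Suc t) (merge I J (x, y)) = reindex y" for x y :: "nat \<Rightarrow> 'x"
  proof -
    have "idx (Suc t) j \<in> J \<and> idx (Suc t) j \<notin> I" if "j < m" for j
      using that by (auto simp: I_def J_def)
    then show ?thesis by (auto simp: batch_def reindex_def merge_def intro!: restrict_ext)
  qed
  have b2: "batch m idx k (merge I J (x, y)) = batch m idx k x" if "k \<in> {1..t}" for k and x y :: "nat \<Rightarrow> 'x"
  proof -
    have "idx k j \<in> I" if "j < m" for j
      using idx_less[of k j] idx_inj[of k j "Suc t"] \<open>k \<in> {1..t}\<close> that t by (force simp: I_def J_def)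
    then show ?thesis by (auto simp: batch_def merge_def intro!: restrict_ext)
  qed
  define H where "H w b = (\<integral>\<^sup>+y. step_err t w b y \<partial>noise (Suc t))" for w b
  have Hw: "H w \<in> borel_measurable (dataset_space m D)" for w
  proof -
    have "(\<lambda>x. step_err t w (fst x) (snd x)) \<in> borel_measurable (dataset_space m D \<Otimes>\<^sub>M noise (Suc t))"
      by (intro measurable_step_err t) (auto simp flip: measurable_dataset_space)
    then show ?thesis
      unfolding H_def[abs_def] by (intro noise_borel_measurable_nn_integral) (simp add: split_beta)
  qed
  have st: "(\<lambda>S. state S \<rho> t) \<in> dataset_space n D \<rightarrow>\<^sub>M borel \<Otimes>\<^sub>M borel"
    using t \<rho> by (intro measurable_state) (auto simp flip: measurable_dataset_space)
  have bt: "(\<lambda>S. batch m idx (Suc t) S) \<in> dataset_space n D \<rightarrow>\<^sub>M dataset_space m X"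
    using t by (intro measurable_batch) (auto simp flip: measurable_dataset_space)
  have HS: "(\<lambda>S. H (snd (state S \<rho> t)) (batch m idx (Suc t) S)) \<in> borel_measurable (dataset_space n D)"
  proof -
    have "(\<lambda>x. step_err t (snd (state (fst x) \<rho> t)) (batch m idx (Suc t) (fst x)) (snd x)) \<in>
        borel_measurable (dataset_space n D \<Otimes>\<^sub>M noise (Suc t))"
      using measurable_compose[OF measurable_compose[OF measurable_fst st] measurable_snd]
        measurable_compose[OF measurable_fst bt]
      by (intro measurable_step_err t) auto
    then show ?thesis
      unfolding H_def by (intro noise_borel_measurable_nn_integral) (simp add: split_beta)
  qed
  have re: "reindex \<in> Pi\<^sub>M J (\<lambda>_. D) \<rightarrow>\<^sub>M dataset_space m D"
    unfolding reindex_def by (intro measurable_restrict measurable_component_singleton) (auto simp: J_def)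
  have inner: "(\<integral>\<^sup>+y. H w (reindex y) \<partial>Pi\<^sub>M J (\<lambda>_. D)) \<le> ennreal (err_bound t)" for w
  proof -
    \<comment> \<open>\<open>idx (Suc t)\<close> is injective on \<open>{..<m}\<close>, so
      renumbering the points with indices in \<open>J\<close> yields a sample of size
      \<open>m\<close>.\<close>
    have "distr (Pi\<^sub>M J (\<lambda>_. D)) (dataset_space m D) reindex = dataset_space m D"
      unfolding reindex_def[abs_def] using prob_space_D idx_inj[of "Suc t" _ "Suc t"] t
      by (intro distr_PiM_reindex) (auto simp: J_def inj_on_def)
    then have "(\<integral>\<^sup>+y. H w (reindex y) \<partial>Pi\<^sub>M J (\<lambda>_. D)) = (\<integral>\<^sup>+b. H w b \<partial>dataset_space m D)"
      using nn_integral_distr[OF re, of "H w"] Hw[of w] by simp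
    then show ?thesis using mean_step_err_le[OF t] by (simp add: H_def)
  qed
  have "(\<integral>\<^sup>+S. H (snd (state S \<rho> t)) (batch m idx (Suc t) S) \<partial>dataset_space n D) =
      (\<integral>\<^sup>+x. (\<integral>\<^sup>+y. H (snd (state (merge I J (x, y)) \<rho> t)) (batch m idx (Suc t) (merge I J (x, y)))
        \<partial>Pi\<^sub>M J (\<lambda>_. D)) \<partial>Pi\<^sub>M I (\<lambda>_. D))"
    using HS unfolding IJ(4)[symmetric] by (intro PD.product_nn_integral_fold IJ)
  also have "\<dots> = (\<integral>\<^sup>+x. (\<integral>\<^sup>+y. H (snd (state x \<rho> t)) (reindex y) \<partial>Pi\<^sub>M J (\<lambda>_. D)) \<partial>Pi\<^sub>M I (\<lambda>_. D))"
  proof -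
    have "state (merge I J (x, y)) \<rho> t = state x \<rho> t" for x y
      using b2 by (intro state_cong) auto
    then show ?thesis by (simp only: b1)
  qed
  also have "\<dots> \<le> (\<integral>\<^sup>+x. ennreal (err_bound t) \<partial>Pi\<^sub>M I (\<lambda>_. D))"
    by (intro nn_integral_mono inner)
  also have "\<dots> = ennreal (err_bound t)"
    using prob_space.emeasure_space_1[OF prob_space_PiM[of I "\<lambda>_. D"]] prob_space_D by simp
  finally show ?thesis by (simp add: H_def)
qed

section \<open>Errors averaged jointly over data and noise\<close>

abbreviation "trial \<equiv> dataset_space n D \<Otimes>\<^sub>M randomness"

lemma prob_space_trial: "prob_space trial"
proof -
  interpret pair_prob_space "dataset_space n D" randomness ..
  show ?thesis by (rule prob_space_axioms)
qed

lemma measurable_state_trial: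
  "t \<le> T \<Longrightarrow> (\<lambda>x. state (fst x) (snd x) t) \<in> trial \<rightarrow>\<^sub>M borel \<Otimes>\<^sub>M borel"
  by (rule measurable_state) (auto simp flip: measurable_dataset_space)

lemma borel_measurable_err:
  assumes "Suc t \<le> T"
  shows "(\<lambda>x. err (fst x) (snd x) t) \<in> borel_measurable trial"
proof -
  note [measurable] = measurable_state_trial[OF assms] measurable_state_trial[OF Suc_leD[OF assms]]
  have [measurable]: "(\<lambda>x. regularized_solution t (snd (state (fst x) (snd x) t))) \<in> borel_measurable trial"
    by (rule measurable_compose[OF _ borel_measurable_regularized_solution]) measurable
  show ?thesis unfolding err_def by measurable
qed

text \<open>For fixed data the noise of the round is drawn afresh; after exchanging the integrals,
  the batch is averaged for fixed noise of the earlier rounds.\<close>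

lemma nn_integral_err_le:
  assumes t: "Suc t \<le> T"
  shows "(\<integral>\<^sup>+x. ennreal (err (fst x) (snd x) t) \<partial>trial) \<le> ennreal (err_bound t)"
proof -
  interpret pair_sigma_finite "dataset_space n D" randomness ..
  let ?f = "\<lambda>S \<rho>. \<integral>\<^sup>+y. step_err t (snd (state S \<rho> t)) (batch m idx (Suc t) S) y \<partial>noise (Suc t)"
  have bt: "(\<lambda>S. batch m idx (Suc t) S) \<in> dataset_space n D \<rightarrow>\<^sub>M dataset_space m X"
    using t by (intro measurable_batch) (auto simp flip: measurable_dataset_space)
  have fm: "(\<lambda>(S, \<rho>). ?f S \<rho>) \<in> borel_measurable trial"
  proof -
    have "(\<lambda>x. step_err t (snd (state (fst (fst x)) (snd (fst x)) t)) (batch m idx (Suc t) (fst (fst x))) (snd x)) \<in>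
        borel_measurable (trial \<Otimes>\<^sub>M noise (Suc t))"
      using measurable_compose[OF measurable_compose[OF measurable_fst measurable_state_trial[OF Suc_leD[OF t]]] measurable_snd]
        measurable_compose[OF measurable_compose[OF measurable_fst measurable_fst] bt]
      by (intro measurable_step_err t) auto
    then show ?thesis
      unfolding split_beta by (intro noise_borel_measurable_nn_integral) (simp add: split_beta)
  qed
  have "(\<integral>\<^sup>+x. ennreal (err (fst x) (snd x) t) \<partial>trial) =
      (\<integral>\<^sup>+S. (\<integral>\<^sup>+\<rho>. ennreal (err S \<rho> t) \<partial>randomness) \<partial>dataset_space n D)"
    using borel_measurable_err[OF t] by (subst randomness.nn_integral_fst[symmetric]) simp_all
  also have "\<dots> = (\<integral>\<^sup>+S. (\<integral>\<^sup>+\<rho>. ?f S \<rho> \<partial>randomness) \<partial>dataset_space n D)"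
  proof (rule nn_integral_cong)
    fix S assume "S \<in> space (dataset_space n D)"
    then have S: "S \<in> space (dataset_space n X)" by (simp add: space_dataset_space)
    have b: "batch m idx (Suc t) S \<in> space (dataset_space m X)"
      using t by (intro batch_in_space S) simp
    have "(\<lambda>x. step_err t (snd (fst x)) (batch m idx (Suc t) S) (snd x)) \<in>
        borel_measurable ((borel \<Otimes>\<^sub>M borel) \<Otimes>\<^sub>M noise (Suc t))"
      using b by (intro measurable_step_err t) auto
    then show "(\<integral>\<^sup>+\<rho>. ennreal (err S \<rho> t) \<partial>randomness) = (\<integral>\<^sup>+\<rho>. ?f S \<rho> \<partial>randomness)"
      unfolding err_eq_step_err
      by (intro nn_integral_resample_noise[OF t S, where F = "\<lambda>s. step_err t (snd s) (batch m idx (Suc t) S)"])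
        (simp add: case_prod_unfold)
  qed
  also have "\<dots> = (\<integral>\<^sup>+\<rho>. (\<integral>\<^sup>+S. ?f S \<rho> \<partial>dataset_space n D) \<partial>randomness)"
    by (rule Fubini'[symmetric]) (use fm in simp)
  also have "\<dots> \<le> (\<integral>\<^sup>+\<rho>. ennreal (err_bound t) \<partial>randomness)"
    by (intro nn_integral_mono expected_err_fixed_noise t)
  also have "\<dots> = ennreal (err_bound t)" by (simp add: randomness.emeasure_space_1 del: One_nat_def)
  finally show ?thesis .
qed

lemma err_bound_nonneg: "err_bound t \<ge> 0"
  using delta_pos L_pos lam_pos less_imp_le[OF sdev_pos]
  by (auto simp: err_bound_def solver_accuracy_def)

lemma
  assumes t: "Suc t \<le> T"
  shows integrable_err: "integrable trial (\<lambda>x. err (fst x) (snd x) t)"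
    and expected_err_le: "(\<integral>x. err (fst x) (snd x) t \<partial>trial) \<le> err_bound t"
proof -
  have n: "err S \<rho> t \<ge> 0" for S \<rho> by (simp add: err_def)
  show i: "integrable trial (\<lambda>x. err (fst x) (snd x) t)"
    using borel_measurable_err[OF t] nn_integral_err_le[OF t] n
    by (intro integrableI_nonneg) (auto intro: le_less_trans)
  have "ennreal (\<integral>x. err (fst x) (snd x) t \<partial>trial) \<le> ennreal (err_bound t)"
    using nn_integral_err_le[OF t] n i by (subst nn_integral_eq_integral[symmetric]) auto
  then show "(\<integral>x. err (fst x) (snd x) t \<partial>trial) \<le> err_bound t"
    using err_bound_nonneg by simp
qed

section \<open>From the errors of the rounds to the expected gap\<close>

abbreviation "output \<equiv> (\<lambda>S \<rho>. run g (R_SVI lam T m idx P z\<^sub>0 S \<rho>))"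

text \<open>Rounding the number of rounds down allows zero rounds, namely when
  \<open>lam > L / (2 * B)\<close>; the starting point is then returned.\<close>

lemma gap_no_rounds:
  assumes "T = 0"
  shows "vi_gap_exists D n Z g randomness output" "vi_gap D n Z g randomness output \<le> L * B"
proof -
  interpret E: prob_space trial by (rule prob_space_trial)
  have "vi_loss D Z g (output S \<rho>) = vi_loss D Z g z\<^sub>0" for S \<rho>
    unfolding run_R_SVI by (simp add: assms)
  then show "vi_gap_exists D n Z g randomness output" "vi_gap D n Z g randomness output \<le> L * B"
    using vi_loss_in_Z[OF z0_in] by (simp_all add: vi_gap_exists_def vi_gap_def case_prod_unfold E.prob_space del: One_nat_def)
qed

lemma gap_rounds:
  assumes T: "T = Suc t"
  shows "vi_gap_exists D n Z g randomness output"
    and "vi_gap D n Z g randomness output \<le>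
      L * err_bound t + B * (2 * lam * B + (\<Sum>k<t. 2 ^ (k + 3) * lam * err_bound k))"
proof -
  interpret E: prob_space trial by (rule prob_space_trial)
  let ?l = "\<lambda>x. vi_loss D Z g (fst (state (fst x) (snd x) T))"
  let ?e = "\<lambda>k x. err (fst x) (snd x) k"
  have ei: "integrable trial (?e k)" "(\<integral>x. ?e k x \<partial>trial) \<le> err_bound k" if "k \<le> t" for k
    using that T integrable_err expected_err_le by auto
  have lm: "?l \<in> borel_measurable trial"
    by (rule measurable_compose[OF measurable_compose[OF measurable_state_trial[OF order_refl] measurable_fst]
          borel_measurable_vi_loss])
  \<comment> \<open>An integrable majorant: the equilibrium in \<open>Z\<close> has loss at most
    \<open>L * B\<close>, and the output is at distance \<open>err\<close> from it.\<close>
  have bound: "\<bar>?l x\<bar> \<le> L * ?e t x + L * B" for x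
  proof -
    let ?u = "regularized_solution t (snd (state (fst x) (snd x) t))"
    have "\<bar>?l x - vi_loss D Z g ?u\<bar> \<le> L * ?e t x"
      using vi_loss_lipschitz unfolding err_def T by auto
    with vi_loss_in_Z[OF regularized_solution_in[of t "snd (state (fst x) (snd x) t)"]] show ?thesis by linarith
  qed
  have li: "integrable trial ?l"
  proof (rule Bochner_Integration.integrable_bound[OF _ lm])
    show "integrable trial (\<lambda>x. L * ?e t x + L * B)" using ei(1)[of t] by (simp del: One_nat_def)
    show "AE x in trial. norm (?l x) \<le> norm (L * ?e t x + L * B)"
      using order_trans[OF bound abs_ge_self] by (intro AE_I2) (simp only: real_norm_def)
  qed
  then show "vi_gap_exists D n Z g randomness output"
    by (simp add: vi_gap_exists_def run_R_SVI case_prod_unfold)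
  let ?r = "\<lambda>x. L * ?e t x + B * (2 * lam * B + (\<Sum>k<t. 2 ^ (k + 3) * lam * ?e k x))"
  have ri: "integrable trial ?r"
    using ei(1) by (intro Bochner_Integration.integrable_add Bochner_Integration.integrable_mult_right
        Bochner_Integration.integrable_sum) (auto simp del: One_nat_def)
  have "vi_gap D n Z g randomness output = (\<integral>x. ?l x \<partial>trial)"
    by (simp add: vi_gap_def run_R_SVI case_prod_unfold)
  also have "\<dots> \<le> (\<integral>x. ?r x \<partial>trial)"
    by (intro integral_mono li ri) (simp only: T vi_loss_state_le)
  also have "\<dots> = L * (\<integral>x. ?e t x \<partial>trial) + B * (2 * lam * B + (\<Sum>k<t. 2 ^ (k + 3) * lam * (\<integral>x. ?e k x \<partial>trial)))"
  proof -
    have si: "integrable trial (\<lambda>x. \<Sum>k<t. 2 ^ (k + 3) * lam * ?e k x)"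
      using ei(1) by (intro Bochner_Integration.integrable_sum Bochner_Integration.integrable_mult_right) auto
    have "(\<integral>x. (\<Sum>k<t. 2 ^ (k + 3) * lam * ?e k x) \<partial>trial) = (\<Sum>k<t. \<integral>x. 2 ^ (k + 3) * lam * ?e k x \<partial>trial)"
      using ei(1) by (intro Bochner_Integration.integral_sum Bochner_Integration.integrable_mult_right) auto
    also have "\<dots> = (\<Sum>k<t. 2 ^ (k + 3) * lam * (\<integral>x. ?e k x \<partial>trial))"
      by (intro sum.cong refl integral_mult_right) (use ei(1) in auto)
    finally show ?thesis using ei(1)[of t] si by (simp add: E.prob_space del: One_nat_def)
  qed
  also have "\<dots> \<le> L * err_bound t + B * (2 * lam * B + (\<Sum>k<t. 2 ^ (k + 3) * lam * err_bound k))"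
    using ei(2) L_pos B_pos lam_pos by (intro add_mono mult_left_mono sum_mono) auto
  finally show "vi_gap D n Z g randomness output \<le>
      L * err_bound t + B * (2 * lam * B + (\<Sum>k<t. 2 ^ (k + 3) * lam * err_bound k))" .
qed

end

section \<open>Rates\<close>

text \<open>Rounding a number that is at least 1 down loses at most a factor 2, and
  \<open>2 / ln 2 \<le> 3\<close> converts the binary logarithm; this is the origin of the
  3.\<close>

lemma batch_size_bounds:
  assumes "n \<ge> 2"
  shows "batch_size n > 0" "real (batch_size n) * log 2 (real n) \<le> real n"
    "real n \<le> 3 * ln (real n) * real (batch_size n)" "batch_size n \<le> n"
proof -
  let ?x = "real n / log 2 (real n)"
  have l: "log 2 (real n) \<ge> 1" using assms by (simp add: le_log_iff)
  have "log 2 (real n) < real n"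
    using less_exp[of n] assms by (simp add: log_less_iff powr_realpow)
  then have x: "?x \<ge> 1" using l by (simp add: field_simps)
  then have fl: "real (batch_size n) = of_int \<lfloor>?x\<rfloor>" by (simp add: batch_size_def)
  have "\<lfloor>?x\<rfloor> \<ge> 1" using x by (simp add: le_floor_iff)
  then have "real (batch_size n) \<ge> 1" unfolding fl by linarith
  then show "batch_size n > 0" by simp
  have le: "real (batch_size n) \<le> ?x" unfolding fl by (rule of_int_floor_le)
  then show m: "real (batch_size n) * log 2 (real n) \<le> real n" using l by (simp add: field_simps)
  have "real (batch_size n) \<le> real (batch_size n) * log 2 (real n)" using l by (simp add: mult_le_cancel_left1)
  then show "batch_size n \<le> n" using m by simp
  have "?x < real (batch_size n) + 1" unfolding fl by linarith
  then have "?x \<le> 2 * real (batch_size n)" using \<open>real (batch_size n) \<ge> 1\<close> by linarith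
  then have "real n \<le> 2 * log 2 (real n) * real (batch_size n)" using l by (simp add: field_simps)
  also have "2 * log 2 (real n) \<le> 3 * ln (real n)"
  proof -
    have "2 * ln (real n) \<le> 3 * ln 2 * ln (real n)"
      using ln2_ge_two_thirds assms by (intro mult_right_mono) auto
    then show ?thesis by (simp add: log_def field_simps)
  qed
  finally show "real n \<le> 3 * ln (real n) * real (batch_size n)" by (simp add: mult_right_mono)
qed

text \<open>The second bound asks for \<open>T > 0\<close> because a negative logarithm is truncated
  to 0. The third says \<open>2 ^ T \<le> sqrt n\<close>, so \<open>T\<close> batches of size
  \<open>n / log 2 n\<close> use at most half of the data.\<close>

lemma num_rounds_bounds:
  assumes "L > 0" "B > 0" "lam > 0"
  defines "T \<equiv> num_rounds L B lam"
  shows "L < 2 ^ Suc T * (B * lam)" "T > 0 \<Longrightarrow> 2 ^ T * (B * lam) \<le> L"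
    and "n \<ge> 1 \<Longrightarrow> L / (B * sqrt (real n)) \<le> lam \<Longrightarrow> 2 * real T \<le> log 2 (real n)"
proof -
  let ?x = "L / (B * lam)"
  have x: "?x > 0" using assms by simp
  have T: "T = nat \<lfloor>log 2 ?x\<rfloor>" by (simp add: T_def num_rounds_def)
  have "log 2 ?x < real (Suc T)" unfolding T by linarith
  then have "?x < 2 ^ Suc T" using x by (simp only: log_less_iff powr_realpow)
  then show "L < 2 ^ Suc T * (B * lam)" using assms by (simp add: field_simps)
  have Tle: "real T \<le> log 2 ?x" if "T > 0" using that unfolding T by linarith
  show "2 ^ T * (B * lam) \<le> L" if "T > 0"
  proof -
    have "2 ^ T \<le> ?x" using Tle[OF that] x by (simp add: le_log_iff powr_realpow)
    then show ?thesis using assms by (simp add: field_simps)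
  qed
  assume n: "n \<ge> 1" and lam: "L / (B * sqrt (real n)) \<le> lam"
  show "2 * real T \<le> log 2 (real n)"
  proof (cases "T = 0")
    case True
    then show ?thesis using n by simp
  next
    case False
    have "?x \<le> sqrt (real n)" using lam assms n by (simp add: field_simps)
    then have "real T \<le> log 2 (sqrt (real n))"
      using Tle False x by (smt (verit) log_le_cancel_iff gr0I)
    also have "\<dots> = log 2 (real n) / 2" using n by (simp add: log_def ln_sqrt)
    finally show ?thesis by simp
  qed
qed

text \<open>Apart from the divisor \<open>2 ^ Suc t * lam\<close>, the three errors are at most
  \<open>x / 5\<close>, \<open>8 * y\<close> and \<open>x\<close>. Their sum is at most
  \<open>8 * (x + y)\<close>, and the constant 48 makes this \<open>lam * B / 6\<close>.\<close>

lemma (in recursive_regularization_population) err_bound_le: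
  assumes lam: "48 / B * (L / sqrt (real m) + L * sqrt (real DIM('a) * ln (2 / \<delta>)) / (real m * \<epsilon>)) \<le> lam"
  shows "err_bound t \<le> B / (5 * 2 ^ Suc t)"
proof -
  define q :: real where "q = 2 ^ Suc t"
  define s where "s = sqrt (real DIM('a) * ln (2 / \<delta>))"
  have q: "q > 0" by (simp add: q_def)
  have s: "s \<ge> 0" using delta_pos delta_less by (simp add: s_def)
  define x y where "x = L / sqrt (real m)" and "y = L * s / (real m * \<epsilon>)"
  have a: "x + y \<le> lam * B / 48"
    using lam B_pos by (simp add: s_def x_def y_def field_simps)
  have nn: "0 \<le> x" "0 \<le> y"
    using L_pos eps_pos s by (auto simp: x_def y_def)
  have "\<delta> * L / (5 * real m) \<le> 1 * L / (5 * sqrt (real m))"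
  proof (rule frac_le)
    show "5 * sqrt (real m) \<le> 5 * real m"
      using m_pos real_sqrt_le_mono[of "real m" "real m * real m"] by simp
    show "\<delta> * L \<le> 1 * L" using delta_less L_pos by (intro mult_right_mono) auto
  qed (use L_pos m_pos in auto)
  then have "\<delta> * L / (5 * real m) \<le> x / 5" by (simp add: x_def)
  with a nn have b: "\<delta> * L / (5 * real m) + 8 * y + x \<le> lam * B / 5"
    by linarith
  have "err_bound t = (\<delta> * L / (5 * real m) + 8 * y + x) / (q * lam)"
    unfolding err_bound_def solver_accuracy_def noise_scale_def q_def[symmetric] s_def x_def y_def real_sqrt_mult
    using q lam_pos m_pos eps_pos by (simp add: field_simps)
  also have "\<dots> \<le> (lam * B / 5) / (q * lam)"
    using q lam_pos by (intro divide_right_mono b) auto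
  also have "\<dots> = B / (5 * q)" using lam_pos by simp
  finally show ?thesis by (simp add: q_def)
qed

text \<open>Every earlier round contributes \<open>4 / 5 * lam * B\<close> to the regularizer, the
  initial regularizer \<open>2 * lam * B\<close>. The last error adds
  \<open>2 / 5 * lam * B\<^sup>2\<close>, since \<open>L \<le> 2 ^ Suc T * (B * lam)\<close>.
  Without rounds the same inequality bounds \<open>L * B\<close>.\<close>

lemma (in recursive_regularization_population) gap_le:
  assumes lam: "48 / B * (L / sqrt (real m) + L * sqrt (real DIM('a) * ln (2 / \<delta>)) / (real m * \<epsilon>)) \<le> lam"
    and T: "L \<le> 2 ^ Suc T * (B * lam)"
  shows "vi_gap_exists D n Z g randomness output"
    and "vi_gap D n Z g randomness output \<le> lam * B\<^sup>2 * (12 / 5 + 4 / 5 * real T)"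
proof -
  have "vi_gap_exists D n Z g randomness output \<and>
    vi_gap D n Z g randomness output \<le> lam * B\<^sup>2 * (12 / 5 + 4 / 5 * real T)"
  proof (cases T)
    case 0
    have "L * B \<le> 2 * lam * B\<^sup>2"
      using T mult_right_mono[OF T, of B] B_pos by (simp add: 0 power2_eq_square mult_ac)
    also have "\<dots> \<le> lam * B\<^sup>2 * (12 / 5)" using lam_pos by simp
    finally show ?thesis using gap_no_rounds[OF 0] 0 by simp
  next
    case (Suc t)
    have "vi_gap D n Z g randomness output \<le>
        L * err_bound t + B * (2 * lam * B + (\<Sum>k<t. 2 ^ (k + 3) * lam * err_bound k))"
      by (rule gap_rounds(2)[OF Suc])
    also have "\<dots> \<le> (2 ^ Suc T * (B * lam)) * (B / (5 * 2 ^ Suc t)) +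
        B * (2 * lam * B + (\<Sum>k<t. 2 ^ (k + 3) * lam * (B / (5 * 2 ^ Suc k))))"
      using B_pos lam_pos L_pos
      by (intro add_mono mult_mono mult_left_mono sum_mono err_bound_le lam T order_refl err_bound_nonneg) auto
    also have "\<dots> = lam * B\<^sup>2 * (2 / 5 + 2 + 4 / 5 * real t)"
    proof -
      have "2 ^ (k + 3) * lam * (B / (5 * 2 ^ Suc k)) = 4 / 5 * lam * B" for k
        by (simp add: power_add field_simps)
      then have 1: "(\<Sum>k<t. 2 ^ (k + 3) * lam * (B / (5 * 2 ^ Suc k))) = real t * (4 / 5 * lam * B)"
        by (simp only: sum_constant card_lessThan)
      have 2: "(2 ^ Suc T * (B * lam)) * (B / (5 * 2 ^ Suc t)) = 2 / 5 * lam * B\<^sup>2"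
        by (simp add: Suc power2_eq_square field_simps)
      show ?thesis unfolding 1 2 by (simp add: power2_eq_square algebra_simps)
    qed
    also have "\<dots> \<le> lam * B\<^sup>2 * (12 / 5 + 4 / 5 * real T)"
      using lam_pos Suc by (intro mult_left_mono) auto
    finally show ?thesis using gap_rounds(1)[OF Suc] by blast
  qed
  then show "vi_gap_exists D n Z g randomness output"
    and "vi_gap D n Z g randomness output \<le> lam * B\<^sup>2 * (12 / 5 + 4 / 5 * real T)" by auto
qed

text \<open>The number of rounds gives one logarithm, and replacing \<open>m\<close> by
  \<open>n\<close> gives another half in the sampling term and a whole one in the privacy term. The
  explicit constants 480 and 1440 are rounded up generously.\<close>

lemma gap_rate:
  fixes T :: nat
  assumes "n \<ge> 2" "L > 0" "B > 0" "\<epsilon> > 0" "0 < \<delta>" "\<delta> \<le> 1 / 2" "d \<ge> 0"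
    and T: "2 * real T \<le> log 2 (real n)"
  defines "m \<equiv> batch_size n"
  defines "lam \<equiv> 48 / B * (L / sqrt (real m) + L * sqrt (d * ln (2 / \<delta>)) / (real m * \<epsilon>))"
  shows "lam * B\<^sup>2 * (12 / 5 + 4 / 5 * real T) \<le>
    10000 * (ln (real n) powr (3 / 2) * B * L / sqrt (real n) +
      (ln (real n))\<^sup>2 * B * L * sqrt (d * ln (1 / \<delta>)) / (real n * \<epsilon>))"
proof -
  define l where "l = ln (real n)"
  have "ln 2 \<le> l" unfolding l_def using assms(1) by simp
  then have l: "l \<ge> 2 / 3" using ln2_ge_two_thirds by linarith
  have m: "m > 0" "real n \<le> 3 * l * real m" using batch_size_bounds[OF assms(1)] by (auto simp: m_def l_def)
  have T': "12 / 5 + 4 / 5 * real T \<le> 5 * l"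
  proof -
    have "log 2 (real n) \<le> 3 / 2 * l"
    proof -
      have "2 / 3 * l \<le> ln 2 * l" using ln2_ge_two_thirds l by (intro mult_right_mono) auto
      then show ?thesis by (simp add: log_def l_def field_simps)
    qed
    then show ?thesis using T l by linarith
  qed
  have n: "real n > 0" using assms by simp
  have m1: "1 / real m \<le> 3 * l / real n" using m n by (simp add: field_simps)
  have m2: "1 / sqrt (real m) \<le> 2 * sqrt l / sqrt (real n)"
  proof -
    have "1 / sqrt (real m) = sqrt (1 / real m)" by (simp add: real_sqrt_divide)
    also have "\<dots> \<le> sqrt (2\<^sup>2 * l / real n)" using m1 l n
      by (intro real_sqrt_le_mono order_trans[OF m1] divide_right_mono) auto
    also have "\<dots> = 2 * sqrt l / sqrt (real n)" by (simp add: real_sqrt_divide real_sqrt_mult)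
    finally show ?thesis .
  qed
  have "ln (2 / \<delta>) \<le> 2\<^sup>2 * ln (1 / \<delta>)"
  proof -
    \<comment> \<open>Here \<open>\<delta> \<le> 1 / 2\<close> enters, as
      \<open>2 / \<delta> \<le> (1 / \<delta>)\<^sup>2\<close>. For \<delta> near 1 the right-hand
      logarithm tends to 0 and the left-hand one does not.\<close>
    have "ln (2 / \<delta>) \<le> ln ((1 / \<delta>)\<^sup>2)"
      using assms by (subst ln_le_cancel_iff) (auto simp: power2_eq_square field_simps)
    also have "\<dots> = 2 * ln (1 / \<delta>)" using assms by (simp add: ln_realpow)
    finally have "ln (2 / \<delta>) \<le> 2 * ln (1 / \<delta>)" .
    moreover have "0 \<le> ln (1 / \<delta>)" using assms(5,6) by simp
    ultimately show ?thesis by simp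
  qed
  then have s: "sqrt (d * ln (2 / \<delta>)) \<le> 2 * sqrt (d * ln (1 / \<delta>))" (is "?s2 \<le> 2 * ?s1")
    using real_sqrt_le_mono[of "d * ln (2 / \<delta>)" "2\<^sup>2 * (d * ln (1 / \<delta>))"] assms(7)
      mult_left_mono[of "ln (2 / \<delta>)" "2\<^sup>2 * ln (1 / \<delta>)" d]
    by (simp only: real_sqrt_mult real_sqrt_abs) (simp add: mult_ac)
  have s1: "?s1 \<ge> 0" "?s2 \<ge> 0" using assms by auto
  have "lam * B\<^sup>2 * (12 / 5 + 4 / 5 * real T) \<le> lam * B\<^sup>2 * (5 * l)"
    using assms(2-4) s1(2) by (intro mult_left_mono T') (auto simp: lam_def)
  also have "\<dots> = 240 * l * B * L * (1 / sqrt (real m)) + 240 * l * B * L * (?s2 * (1 / real m)) / \<epsilon>"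
    using assms(3) by (simp add: lam_def power2_eq_square field_simps)
  also have "\<dots> \<le> 240 * l * B * L * (2 * sqrt l / sqrt (real n)) + 240 * l * B * L * ((2 * ?s1) * (3 * l / real n)) / \<epsilon>"
    using l assms(2-4) s1 by (intro add_mono divide_right_mono mult_left_mono mult_mono m1 m2 s) auto
  also have "\<dots> = 480 * ((l * sqrt l) * B * L / sqrt (real n)) + 1440 * (l\<^sup>2 * B * L * ?s1 / (real n * \<epsilon>))"
    by (simp add: power2_eq_square mult_ac)
  also have "\<dots> \<le> 10000 * ((l * sqrt l) * B * L / sqrt (real n)) + 10000 * (l\<^sup>2 * B * L * ?s1 / (real n * \<epsilon>))"
    using l assms(2-4) s1 by (intro add_mono mult_right_mono) auto
  also have "l * sqrt l = l powr (3 / 2)"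
    using l powr_add[of l 1 "1 / 2"] by (simp add: powr_half_sqrt)
  finally show ?thesis by (simp add: l_def distrib_left)
qed

text \<open>The ratio inside the logarithm is \<open>5 * c * (m / \<delta>)\<close> times a factor
  that is at most 1 until the last round. The additive constants are absorbed because
  \<open>ln (n / \<delta>) \<ge> ln 2 \<ge> 2 / 3\<close>.\<close>

lemma solver_K_le:
  assumes "L > 0" "B > 0" "lam > 0" "c > 0" "0 < \<delta>" "\<delta> < 1" "n \<ge> 2" "0 < m" "m \<le> n"
    and "2 ^ t * (B * lam) \<le> L"
  shows "solver_K c L B lam m \<delta> t \<le> 7 * (1 + \<bar>ln c\<bar>) * ln (real n / \<delta>)"
proof -
  define l where "l = ln (real n / \<delta>)"
  have "ln 2 \<le> l" unfolding l_def using assms by (subst ln_le_cancel_iff) (auto simp: field_simps intro: order_trans[of _ 2])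
  then have l: "l \<ge> 2 / 3" using ln2_ge_two_thirds by linarith
  have "c * B / solver_accuracy L lam m \<delta> t = 5 * c * (real m / \<delta>) * (2 ^ t * (B * lam) / L)"
    using assms by (simp add: solver_accuracy_def field_simps)
  also have "\<dots> \<le> 5 * c * (real n / \<delta>) * 1"
    using assms by (intro mult_mono divide_right_mono) auto
  finally have "ln (c * B / solver_accuracy L lam m \<delta> t) \<le> ln (5 * c * (real n / \<delta>))"
    using assms by (subst ln_le_cancel_iff) (auto simp: solver_accuracy_def)
  also have "\<dots> = ln 5 + ln c + l"
    unfolding l_def using assms by (subst ln_mult, simp, simp, subst ln_mult) auto
  also have "\<dots> \<le> 4 + \<bar>ln c\<bar> + l" using ln_le_minus_one[of "5::real"] by simp
  also have "\<dots> \<le> 7 * (1 + \<bar>ln c\<bar>) * l"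
  proof -
    have "\<bar>ln c\<bar> * (2 / 3) \<le> \<bar>ln c\<bar> * l" using l by (intro mult_left_mono) auto
    then show ?thesis using l by (simp add: algebra_simps)
  qed
  finally have "ln (c * B / solver_accuracy L lam m \<delta> t) \<le> 7 * (1 + \<bar>ln c\<bar>) * l" .
  moreover have "1 \<le> 7 * (1 + \<bar>ln c\<bar>) * l"
  proof -
    have "0 \<le> \<bar>ln c\<bar> * l" using l by simp
    moreover have "7 * (1 + \<bar>ln c\<bar>) * l = 7 * l + 7 * (\<bar>ln c\<bar> * l)" by (simp add: algebra_simps)
    ultimately show ?thesis using l by linarith
  qed
  ultimately show ?thesis by (simp add: solver_K_def l_def)
qed

text \<open>The linear parts add up to at most \<open>n\<close>, as the batches are disjoint parts
  of the data. The conditioning improves geometrically, so the other parts cost no extra logarithm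
  in the number of rounds. The lower bound on \<open>lam\<close> turns \<open>sqrt m / lam\<close>
  into \<open>B / L * n\<close>; the factor \<open>B / L\<close> makes
  \<open>\<beta> * B / L\<close> scale-free.\<close>

lemma evals_rate:
  assumes "L > 0" "B > 0" "lam > 0" "c > 0" "c\<^sub>0 > 0" "0 < \<delta>" "\<delta> < 1" "n \<ge> 2" "\<beta> \<ge> 0"
    and T: "2 * real T \<le> log 2 (real n)" "T > 0 \<Longrightarrow> 2 ^ T * (B * lam) \<le> L"
    and m: "0 < m" "m \<le> n" "real m * log 2 (real n) \<le> real n" and lam: "48 / B * (L / sqrt (real m)) \<le> lam"
  shows "(\<Sum>k = 1..T. c\<^sub>0 * (real m + sqrt (real m) * solver_K c L B lam m \<delta> k * \<beta> / (2 ^ k * lam))) \<le>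
    100 * c\<^sub>0 * (1 + (1 + \<bar>ln c\<bar>) * B / L) * (real n + \<beta> * real n * ln (real n / \<delta>))"
proof -
  define \<kappa> where "\<kappa> = 7 * (1 + \<bar>ln c\<bar>) * ln (real n / \<delta>)"
  have nd: "ln (real n / \<delta>) \<ge> 0" using assms by (auto intro!: ln_ge_zero simp: field_simps)
  then have \<kappa>: "\<kappa> \<ge> 0" by (simp add: \<kappa>_def)
  have K: "solver_K c L B lam m \<delta> k \<le> \<kappa>" if "k \<in> {1..T}" for k
    unfolding \<kappa>_def
  proof (rule solver_K_le)
    have "2 ^ k * (B * lam) \<le> 2 ^ T * (B * lam)"
      using that assms by (intro mult_right_mono power_increasing) auto
    then show "2 ^ k * (B * lam) \<le> L" using T(2) that by simp
  qed (use assms in auto)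
  have sq: "sqrt (real m) / lam \<le> B / L * real n"
  proof -
    have "sqrt (real m) * L = real m * (L / sqrt (real m))"
      using m by (simp add: field_simps)
    also have "\<dots> \<le> real m * (lam * B)"
    proof (intro mult_left_mono)
      have "0 \<le> L / sqrt (real m)" using \<open>L > 0\<close> by simp
      then have "L / sqrt (real m) \<le> 48 * (L / sqrt (real m))" by linarith
      also have "\<dots> \<le> lam * B"
      proof -
        have "48 * (L / sqrt (real m)) / B \<le> lam" using lam by (simp add: mult.commute)
        then show ?thesis by (simp only: pos_divide_le_eq[OF \<open>B > 0\<close>])
      qed
      finally show "L / sqrt (real m) \<le> lam * B" .
    qed auto
    also have "\<dots> \<le> real n * (lam * B)" using m assms by (intro mult_right_mono) auto
    finally show ?thesis using assms by (simp add: field_simps)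
  qed
  have geo: "(\<Sum>k = 1..T. (1 / 2 :: real) ^ k) \<le> 1"
  proof -
    have "(\<Sum>k = 1..T. (1 / 2 :: real) ^ k) = 1 - (1 / 2) ^ T" by (induction T) auto
    then show ?thesis by simp
  qed
  have "(\<Sum>k = 1..T. c\<^sub>0 * (real m + sqrt (real m) * solver_K c L B lam m \<delta> k * \<beta> / (2 ^ k * lam))) \<le>
      (\<Sum>k = 1..T. c\<^sub>0 * (real m + sqrt (real m) * \<kappa> * \<beta> / (2 ^ k * lam)))"
    using assms by (intro sum_mono mult_left_mono add_left_mono divide_right_mono mult_right_mono K) auto
  also have "\<dots> = c\<^sub>0 * (real T * real m + \<kappa> * \<beta> * (sqrt (real m) / lam) * (\<Sum>k = 1..T. (1 / 2) ^ k))"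
    by (simp add: sum_distrib_left sum.distrib distrib_left power_one_over field_simps)
  also have "\<dots> \<le> c\<^sub>0 * (real n + \<kappa> * \<beta> * (B / L * real n) * 1)"
  proof (intro mult_left_mono add_mono)
    have "real m * (2 * real T) \<le> real m * log 2 (real n)" by (intro mult_left_mono T) simp
    moreover have "real m * (2 * real T) = 2 * (real T * real m)" "0 \<le> real T * real m" by simp_all
    ultimately show "real T * real m \<le> real n" using m(3) by linarith
    show "\<kappa> * \<beta> * (sqrt (real m) / lam) * (\<Sum>k = 1..T. (1 / 2) ^ k) \<le> \<kappa> * \<beta> * (B / L * real n) * 1"
      using \<kappa> assms by (intro mult_mono sq geo mult_nonneg_nonneg) (auto intro: sum_nonneg)
  qed (use assms in auto)
  also have "\<dots> = c\<^sub>0 * (1 * real n + 7 * ((1 + \<bar>ln c\<bar>) * B / L) * (\<beta> * real n * ln (real n / \<delta>)))"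
    by (simp add: \<kappa>_def)
  also have "\<dots> \<le> c\<^sub>0 * ((100 * (1 + (1 + \<bar>ln c\<bar>) * B / L)) * real n +
      (100 * (1 + (1 + \<bar>ln c\<bar>) * B / L)) * (\<beta> * real n * ln (real n / \<delta>)))"
  proof -
    have *: "1 \<le> 100 * (1 + r)" "7 * r \<le> 100 * (1 + r)" if "0 \<le> r" for r :: real
      using that by auto
    have "0 \<le> (1 + \<bar>ln c\<bar>) * B / L" using assms by auto
    from *[OF this] show ?thesis
      by (intro mult_left_mono add_mono mult_right_mono) (use assms nd in auto)
  qed
  also have "c\<^sub>0 * ((100 * q) * x + (100 * q) * y) = 100 * c\<^sub>0 * q * (x + y)" for q x y
    by (simp add: algebra_simps)
  finally show ?thesis .
qed

text \<open>Privacy is stated for \<open>\<epsilon> \<le> 2 * ln (2 / \<delta>)\<close>, the range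
  in which the Chernoff bound closes at this noise scale. Seeds and solvers are indexed by the round
  because accuracy and strong monotonicity change with it.\<close>

theorem theorem6:
  fixes X :: "'x measure"
    and Z :: "'a::euclidean_space set"
    and g :: "'a \<Rightarrow> 'x \<Rightarrow> 'a"
    and n :: nat
    and L \<beta> B \<epsilon> \<delta> lam c c\<^sub>0 :: real
    and idx :: "nat \<Rightarrow> nat \<Rightarrow> nat"
    and W :: "nat \<Rightarrow> 'w measure"
    and P :: "nat \<Rightarrow> 'w \<Rightarrow> (nat \<Rightarrow> 'x) \<Rightarrow> ('a \<Rightarrow> 'a) \<Rightarrow> ('a, 'x, 'a) grad_prog"
    and z\<^sub>0 :: 'a
  defines "m \<equiv> batch_size n"
    and "T \<equiv> num_rounds L B lam"
  defines "R \<equiv> R_SVI_randomness T W (noise_scale L lam m \<epsilon> \<delta>)"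
    and "prog \<equiv> R_SVI lam T m idx P z\<^sub>0"
  assumes "compact Z" "convex Z" "diameter Z = B" "B > 0"
    and "svi_operator X Z g L \<beta>" "L > 0"
    and "n \<ge> 2" "\<epsilon> > 0" "0 < \<delta>" "\<delta> < 1"
    and "lam \<ge> L / (B * sqrt (real n))"
    and "z\<^sub>0 \<in> Z" "disjoint_batches n T m idx"
    and "c > 0" "c\<^sub>0 > 0"
    and "\<And>t. t \<in> {1..T} \<Longrightarrow>
      accelerated_solver c c\<^sub>0 X Z g \<beta> m (2 ^ t * lam) (solver_K c L B lam m \<delta> t) (W t) (P t)"
  shows "(\<epsilon> \<le> 2 * ln (2 / \<delta>) \<longrightarrow>
           differentially_private \<epsilon> \<delta> X n (\<lambda>S. distr R borel (\<lambda>\<rho>. run g (prog S \<rho>)))) \<and>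
         (lam = 48 / B * (L / sqrt (real m) +
                 L * sqrt (real DIM('a) * ln (2 / \<delta>)) / (real m * \<epsilon>)) \<longrightarrow>
           (\<delta> \<le> 1 / 2 \<longrightarrow> (\<forall>D. prob_space D \<and> sets D = sets X \<longrightarrow>
              vi_gap_exists D n Z g R (\<lambda>S \<rho>. run g (prog S \<rho>)) \<and>
              vi_gap D n Z g R (\<lambda>S \<rho>. run g (prog S \<rho>))
                \<le> 10000 * (ln (real n) powr (3 / 2) * B * L / sqrt (real n) +
                     (ln (real n))\<^sup>2 * B * L * sqrt (real DIM('a) * ln (1 / \<delta>)) /
                       (real n * \<epsilon>)))) \<and>
           (\<forall>S\<in>space (dataset_space n X). \<forall>\<rho>\<in>space R.
              real (evals g (prog S \<rho>))
                \<le> 100 * c\<^sub>0 * (1 + (1 + \<bar>ln c\<bar>) * B / L) *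
                    (real n + \<beta> * real n * ln (real n / \<delta>))))"
proof -
  note m_bounds = batch_size_bounds[OF \<open>n \<ge> 2\<close>, folded m_def]
  have "0 < L / (B * sqrt (real n))" using \<open>L > 0\<close> \<open>B > 0\<close> \<open>n \<ge> 2\<close> by simp
  then have lam: "lam > 0" using assms(15) by linarith
  interpret recursive_regularization X Z g n m T L \<beta> B \<epsilon> \<delta> lam c c\<^sub>0 idx W P z\<^sub>0
    by (rule recursive_regularization.intro[OF assms(5-10,12-14) lam m_bounds(1) assms(18,16,17,20)])
  note T_bounds = num_rounds_bounds[OF \<open>L > 0\<close> \<open>B > 0\<close> lam, folded T_def]
  have T: "2 * real T \<le> log 2 (real n)" using T_bounds(3)[of n] assms(11,15) by simp
  have R: "R = randomness" unfolding R_def by (rule randomness_eq)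
  show ?thesis
    unfolding R prog_def
  proof (intro conjI impI allI ballI)
    show "differentially_private \<epsilon> \<delta> X n
        (\<lambda>S. distr randomness borel (\<lambda>\<rho>. run g (R_SVI lam T m idx P z\<^sub>0 S \<rho>)))" if "\<epsilon> \<le> 2 * ln (2 / \<delta>)"
      using that by (rule R_SVI_privacy)
  next
    assume lam_eq: "lam = 48 / B * (L / sqrt (real m) + L * sqrt (real DIM('a) * ln (2 / \<delta>)) / (real m * \<epsilon>))"
    {
      fix D :: "'x measure"
      assume \<delta>: "\<delta> \<le> 1 / 2" and D: "prob_space D \<and> sets D = sets X"
      interpret recursive_regularization_population X Z g n m T L \<beta> B \<epsilon> \<delta> lam c c\<^sub>0 idx W P z\<^sub>0 D
        using D by (intro recursive_regularization_population.intro recursive_regularization_axioms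
            recursive_regularization_population_axioms.intro) auto
      note gap = gap_le[OF eq_refl[OF lam_eq[symmetric]] less_imp_le[OF T_bounds(1)]]
      show "vi_gap_exists D n Z g randomness (\<lambda>S \<rho>. run g (R_SVI lam T m idx P z\<^sub>0 S \<rho>))"
        by (rule gap)
      show "vi_gap D n Z g randomness (\<lambda>S \<rho>. run g (R_SVI lam T m idx P z\<^sub>0 S \<rho>))
          \<le> 10000 * (ln (real n) powr (3 / 2) * B * L / sqrt (real n) +
              (ln (real n))\<^sup>2 * B * L * sqrt (real DIM('a) * ln (1 / \<delta>)) / (real n * \<epsilon>))"
        by (rule order_trans[OF gap(2) gap_rate[OF \<open>n \<ge> 2\<close> \<open>L > 0\<close> \<open>B > 0\<close> \<open>\<epsilon> > 0\<close> \<open>0 < \<delta>\<close> \<delta>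
            of_nat_0_le_iff[of "DIM('a)"] T, folded m_def, folded lam_eq]])
    next
      fix S \<rho>
      assume S: "S \<in> space (dataset_space n X)" and \<rho>: "\<rho> \<in> space randomness"
      have "S 0 \<in> space X" using S \<open>n \<ge> 2\<close> by (simp add: space_PiM PiE_iff)
      from operator_at(3)[OF this] have \<beta>: "\<beta> \<ge> 0" by (rule lipschitz_on_nonneg)
      have "0 \<le> L * sqrt (real DIM('a) * ln (2 / \<delta>)) / (real m * \<epsilon>)"
        using \<open>L > 0\<close> \<open>\<epsilon> > 0\<close> \<open>0 < \<delta>\<close> \<open>\<delta> < 1\<close>
        by (intro divide_nonneg_nonneg mult_nonneg_nonneg real_sqrt_ge_zero ln_ge_zero) simp_all
      then have lam_ge: "48 / B * (L / sqrt (real m)) \<le> lam"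
        unfolding lam_eq using \<open>B > 0\<close> by (intro mult_left_mono) auto
      show "real (evals g (R_SVI lam T m idx P z\<^sub>0 S \<rho>)) \<le>
          100 * c\<^sub>0 * (1 + (1 + \<bar>ln c\<bar>) * B / L) * (real n + \<beta> * real n * ln (real n / \<delta>))"
        by (rule order_trans[OF evals_R_SVI[OF S \<rho>] evals_rate[OF \<open>L > 0\<close> \<open>B > 0\<close> lam \<open>c > 0\<close> \<open>c\<^sub>0 > 0\<close>
            \<open>0 < \<delta>\<close> \<open>\<delta> < 1\<close> \<open>n \<ge> 2\<close> \<beta> T T_bounds(2) m_bounds(1,4,2) lam_ge]])
    }
  qed
qed

end
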